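(* Let $\mathcal{C}$ be a class of topological semigroups such that $\mathsf{T}_{\mathsf z}\mathsf{S}\subseteq\mathcal{C}\subseteq\mathsf{T}_1\mathsf{S}$. A unipotent commutative semigroup $X$ is $\mathcal{C}$-closed if and only if $X$ is bounded and nonsingular.
   Context: A topological semigroup is a topological space $X$ endowed with a continuous associative binary operation $X\times X\to X$, $(x,y)\mapsto xy$. $\mathsf{T}_1\mathsf{S}$ denotes the class of topological semigroups satisfying the separation axiom $T_1$ (all finite subsets are closed). $\mathsf{T}_{\mathsf z}\mathsf{S}$ denotes the class of Hausdorff zero-dimensional topological semigroups, where a space is zero-dimensional if it has a base of the topology consisting of clopen sets. A topological semigroup $X$ is $\mathcal{C}$-closed if for any homomorphism $h:X\to Y$ to a topological semigroup $Y\in\mathcal{C}$ that is a topological embedding, the image $h[X]$ is closed in $Y$. A semigroup $X$ (without topology) is $\mathcal{C}$-closed if $X$ endowed with the discrete topology is $\mathcal{C}$-closed. A semigroup $X$ is: unipotent if it contains a unique idempotent; bounded if there exists $n\in\mathbb{N}=\{1,2,3,\dots\}$ such that for every $x\in X$ the power $x^n$ is an idempotent; singular if there exists an infinite set $A\subseteq X$ such that $AA=\{ab:a,b\in A\}$ is a singleton; nonsingular if it is not singular. *)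

theory Defs
  imports "HOL-Analysis.Analysis" "HOL-Library.Equipollence"
begin

definition is_semigroup :: "'a set \<Rightarrow> ('a \<Rightarrow> 'a \<Rightarrow> 'a) \<Rightarrow> bool" where
  "is_semigroup X m \<longleftrightarrow>
     (\<forall>x\<in>X. \<forall>y\<in>X. m x y \<in> X) \<and>
     (\<forall>x\<in>X. \<forall>y\<in>X. \<forall>z\<in>X. m (m x y) z = m x (m y z))"

definition is_commutative :: "'a set \<Rightarrow> ('a \<Rightarrow> 'a \<Rightarrow> 'a) \<Rightarrow> bool" where
  "is_commutative X m \<longleftrightarrow> (\<forall>x\<in>X. \<forall>y\<in>X. m x y = m y x)"

definition semigroup_hom ::
  "'a set \<Rightarrow> ('a \<Rightarrow> 'a \<Rightarrow> 'a) \<Rightarrow> 'b set \<Rightarrow> ('b \<Rightarrow> 'b \<Rightarrow> 'b) \<Rightarrow> ('a \<Rightarrow> 'b) \<Rightarrow> bool" where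
  "semigroup_hom X m Y n h \<longleftrightarrow>
     h ` X \<subseteq> Y \<and> (\<forall>x\<in>X. \<forall>y\<in>X. h (m x y) = n (h x) (h y))"

definition idempotent :: "('a \<Rightarrow> 'a \<Rightarrow> 'a) \<Rightarrow> 'a \<Rightarrow> bool" where
  "idempotent m e \<longleftrightarrow> m e e = e"

text \<open>The power \<open>x\<^sup>n\<close> in a semigroup, meaningful for \<open>n \<ge> 1\<close> only: the value at \<open>n = 0\<close> is a
  dummy.\<close>
definition semigroup_power :: "('a \<Rightarrow> 'a \<Rightarrow> 'a) \<Rightarrow> 'a \<Rightarrow> nat \<Rightarrow> 'a" where
  "semigroup_power m x n = (m x ^^ (n - 1)) x"

definition unipotent :: "'a set \<Rightarrow> ('a \<Rightarrow> 'a \<Rightarrow> 'a) \<Rightarrow> bool" where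
  "unipotent X m \<longleftrightarrow> (\<exists>!e. e \<in> X \<and> idempotent m e)"

definition bounded_semigroup :: "'a set \<Rightarrow> ('a \<Rightarrow> 'a \<Rightarrow> 'a) \<Rightarrow> bool" where
  "bounded_semigroup X m \<longleftrightarrow>
     (\<exists>n\<ge>1. \<forall>x\<in>X. idempotent m (semigroup_power m x n))"

definition singular :: "'a set \<Rightarrow> ('a \<Rightarrow> 'a \<Rightarrow> 'a) \<Rightarrow> bool" where
  "singular X m \<longleftrightarrow>
     (\<exists>A\<subseteq>X. infinite A \<and> (\<exists>c. {m a b | a b. a \<in> A \<and> b \<in> A} = {c}))"

definition nonsingular :: "'a set \<Rightarrow> ('a \<Rightarrow> 'a \<Rightarrow> 'a) \<Rightarrow> bool" where
  "nonsingular X m \<longleftrightarrow> \<not> singular X m"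

text \<open>A topological semigroup is encoded as a pair of a topology \<open>T\<close> and an operation; its carrier is
  \<open>topspace T\<close>, and the values of the operation outside the carrier are irrelevant.\<close>
type_synonym 'a topsemigroup = "'a topology \<times> ('a \<Rightarrow> 'a \<Rightarrow> 'a)"

definition topological_semigroup :: "'a topsemigroup \<Rightarrow> bool" where
  "topological_semigroup = (\<lambda>(T, m). is_semigroup (topspace T) m \<and>
     continuous_map (prod_topology T T) T (\<lambda>(x, y). m x y))"

definition zero_dimensional_space :: "'a topology \<Rightarrow> bool" where
  "zero_dimensional_space T \<longleftrightarrow>
     (\<exists>\<B>. (\<forall>V\<in>\<B>. openin T V \<and> closedin T V) \<and>
          (\<forall>U x. openin T U \<and> x \<in> U \<longrightarrow> (\<exists>V\<in>\<B>. x \<in> V \<and> V \<subseteq> U)))"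

text \<open>The classes of topological semigroups with carrier in a host type \<open>'b\<close>. The host type is
  arbitrary, and a class of topological semigroups is represented by its members living on \<open>'b\<close>.\<close>
definition T1S :: "'b topsemigroup set" where
  "T1S = {(T, m). topological_semigroup (T, m) \<and> t1_space T}"

definition TzS :: "'b topsemigroup set" where
  "TzS = {(T, m). topological_semigroup (T, m) \<and> Hausdorff_space T \<and> zero_dimensional_space T}"

definition closed_topsemigroup :: "'b topsemigroup set \<Rightarrow> 'a topsemigroup \<Rightarrow> bool" where
  "closed_topsemigroup \<C> = (\<lambda>(T, m). \<forall>S n h.
     (S, n) \<in> \<C> \<and> semigroup_hom (topspace T) m (topspace S) n h \<and> embedding_map T S h \<longrightarrow>
     closedin S (h ` topspace T))"

text \<open>Closedness of the semigroup \<open>X\<close> without topology. This is meaningful only if the host type \<open>'b\<close>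
  of \<open>\<C>\<close> is large enough to contain a copy of \<open>X\<close>; otherwise it holds vacuously.\<close>
definition closed_semigroup ::
  "'b topsemigroup set \<Rightarrow> 'a set \<Rightarrow> ('a \<Rightarrow> 'a \<Rightarrow> 'a) \<Rightarrow> bool" where
  "closed_semigroup \<C> X m \<longleftrightarrow> closed_topsemigroup \<C> (discrete_topology X, m)"

end

theory Submission
  imports Defs "HOL-Algebra.Group"
begin

text \<open>
  Suppose \<open>X\<close> is bounded and nonsingular with idempotent \<open>e\<close>, and let \<open>y\<close> lie in the closure of
  \<open>X\<close> in a \<open>T\<^sub>1\<close> topological semigroup. The high powers of elements of \<open>X\<close> lie in the group \<open>eX\<close>,
  and a neighbourhood of \<open>y^p\<close> whose \<open>2N\<close>-fold products in \<open>X\<close> all equal \<open>e\<close> meets that group in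
  a single point, so \<open>y^p \<in> X\<close> for large \<open>p\<close>. If \<open>z\<close> is in the closure and \<open>z\<^sup>2 \<in> X\<close>, then a
  neighbourhood \<open>V\<close> of \<open>z\<close> has \<open>(V \<inter> X)(V \<inter> X) = {z\<^sup>2}\<close>, so nonsingularity makes \<open>V \<inter> X\<close> finite and
  \<open>z \<in> X\<close>; halving exponents along powers of two gives \<open>y \<in> X\<close>.

  Conversely, \<open>X\<close> embeds as a discrete nonclosed subsemigroup into a semigroup of filters on \<open>X\<close> in
  each of the following cases: \<open>X\<close> is singular (use a free ultrafilter on an infinite
  set whose pairwise products are all equal); some element has
  no idempotent power (use its powers with highly divisible exponents); the group \<open>eX\<close> is
  periodic but unbounded (use products of \<open>k\<close> far terms of a sequence of rapidly growing orders).
  If none applies, \<open>x^q\<close> lies in the nil semigroup \<open>{x. ex = e}\<close> for some fixed \<open>q\<close>, and a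
  nonsingular nil semigroup is bounded.
\<close>

section \<open>Semigroups of filters\<close>

lemma singularI:
  assumes "A \<subseteq> X" "infinite A" "\<And>a b. a \<in> A \<Longrightarrow> b \<in> A \<Longrightarrow> m a b = c"
  shows "singular X m"
proof -
  obtain a where "a \<in> A" using assms(2) by (metis finite.emptyI ex_in_conv)
  then have "{m a b | a b. a \<in> A \<and> b \<in> A} = {c}" using assms(3) by blast
  then show ?thesis using assms(1,2) unfolding singular_def by blast
qed

definition filter_mult :: "('a \<Rightarrow> 'a \<Rightarrow> 'a) \<Rightarrow> 'a filter \<Rightarrow> 'a filter \<Rightarrow> 'a filter" where
  "filter_mult m F G = filtermap (\<lambda>(x, y). m x y) (F \<times>\<^sub>F G)"

definition filters_on :: "'a set \<Rightarrow> 'a filter set" where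
  "filters_on X = {F. F \<noteq> bot \<and> eventually (\<lambda>x. x \<in> X) F}"

lemma eventually_filter_mult:
  "eventually P (filter_mult m F G) \<longleftrightarrow>
     (\<exists>Q R. eventually Q F \<and> eventually R G \<and> (\<forall>x y. Q x \<longrightarrow> R y \<longrightarrow> P (m x y)))"
  by (simp add: filter_mult_def eventually_filtermap eventually_prod_filter)

lemma filter_mult_principal_left: "filter_mult m (principal {x}) F = filtermap (m x) F"
proof -
  have "(\<exists>Q R. Q x \<and> eventually R F \<and> (\<forall>x y. Q x \<longrightarrow> R y \<longrightarrow> P (m x y))) \<longleftrightarrow>
      eventually (\<lambda>y. P (m x y)) F" for P
  proof
    assume "eventually (\<lambda>y. P (m x y)) F"
    then show "\<exists>Q R. Q x \<and> eventually R F \<and> (\<forall>x y. Q x \<longrightarrow> R y \<longrightarrow> P (m x y))"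
      by (intro exI[of _ "\<lambda>z. z = x"] exI[of _ "\<lambda>y. P (m x y)"]) auto
  qed (auto elim: eventually_mono)
  then show ?thesis
    by (simp add: filter_eq_iff eventually_filter_mult eventually_filtermap eventually_principal)
qed

lemma filter_mult_principal [simp]:
  "filter_mult m (principal {x}) (principal {y}) = principal {m x y}"
  by (simp add: filter_mult_principal_left filtermap_principal)

lemma principal_in_filters_on: "x \<in> X \<Longrightarrow> principal {x} \<in> filters_on X"
  by (simp add: filters_on_def principal_eq_bot_iff eventually_principal)

lemma proper_filter_le_principal_singleton:
  assumes "F \<noteq> bot" "F \<le> principal {x}" shows "F = principal {x}"
proof (rule antisym[OF assms(2)], rule filter_leI)
  fix P assume "eventually P F"
  moreover have "eventually (\<lambda>y. y = x) F"
    using assms(2) by (simp add: le_principal)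
  ultimately have "eventually (\<lambda>y. P y \<and> y = x) F" by (rule eventually_conj)
  then have "P x" using eventually_happens' [OF assms(1)] by blast
  then show "eventually P (principal {x})" by (simp add: eventually_principal)
qed

locale carrier_semigroup =
  fixes X :: "'a set" and m :: "'a \<Rightarrow> 'a \<Rightarrow> 'a"
  assumes semigroup: "is_semigroup X m"
begin

lemma closed [simp, intro]: "x \<in> X \<Longrightarrow> y \<in> X \<Longrightarrow> m x y \<in> X"
  using semigroup by (simp add: is_semigroup_def)

lemma assoc: "x \<in> X \<Longrightarrow> y \<in> X \<Longrightarrow> z \<in> X \<Longrightarrow> m (m x y) z = m x (m y z)"
  using semigroup by (simp add: is_semigroup_def)

lemma filter_mult_closed:
  assumes "F \<in> filters_on X" "G \<in> filters_on X"
  shows "filter_mult m F G \<in> filters_on X"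
proof -
  have "filter_mult m F G \<noteq> bot"
    using assms by (auto simp: filter_mult_def filters_on_def filtermap_bot_iff prod_filter_eq_bot)
  then show ?thesis
    using assms by (auto simp: filters_on_def eventually_filter_mult)
qed

lemma filter_mult_assoc:
  assumes "F \<in> filters_on X" "G \<in> filters_on X" "H \<in> filters_on X"
  shows "filter_mult m (filter_mult m F G) H = filter_mult m F (filter_mult m G H)"
proof -
  let ?Q = "\<lambda>P. \<exists>A B C. eventually A F \<and> eventually B G \<and> eventually C H \<and>
      (\<forall>x y z. A x \<longrightarrow> B y \<longrightarrow> C z \<longrightarrow> P (m x (m y z)))"
  have FX: "eventually (\<lambda>x. x \<in> X) F" "eventually (\<lambda>x. x \<in> X) G" "eventually (\<lambda>x. x \<in> X) H"
    using assms by (auto simp: filters_on_def)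
  have "eventually P (filter_mult m (filter_mult m F G) H) \<longleftrightarrow> ?Q P" for P
  proof
    assume "eventually P (filter_mult m (filter_mult m F G) H)"
    then obtain A B C where *: "eventually A F" "eventually B G" "eventually C H"
      "\<And>x y z. A x \<Longrightarrow> B y \<Longrightarrow> C z \<Longrightarrow> P (m (m x y) z)"
      unfolding eventually_filter_mult by blast
    show "?Q P"
      by (rule exI[of _ "\<lambda>x. A x \<and> x \<in> X"], rule exI[of _ "\<lambda>x. B x \<and> x \<in> X"],
          rule exI[of _ "\<lambda>x. C x \<and> x \<in> X"])
        (use * FX in \<open>auto simp: eventually_conj_iff assoc[symmetric]\<close>)
  next
    assume "?Q P"
    then obtain A B C where *: "eventually A F" "eventually B G" "eventually C H"
      "\<And>x y z. A x \<Longrightarrow> B y \<Longrightarrow> C z \<Longrightarrow> P (m x (m y z))" by blast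
    define A' where "A' x \<longleftrightarrow> A x \<and> x \<in> X" for x
    define B' where "B' x \<longleftrightarrow> B x \<and> x \<in> X" for x
    define C' where "C' x \<longleftrightarrow> C x \<and> x \<in> X" for x
    have "eventually A' F" "eventually B' G" "eventually C' H"
      using * FX unfolding A'_def B'_def C'_def eventually_conj_iff by blast+
    moreover have "P (m (m x y) z)" if "A' x" "B' y" "C' z" for x y z
      using that *(4) by (simp add: A'_def B'_def C'_def assoc)
    ultimately show "eventually P (filter_mult m (filter_mult m F G) H)"
      unfolding eventually_filter_mult
      by (intro exI[of _ "\<lambda>w. \<exists>x y. A' x \<and> B' y \<and> w = m x y"] exI[of _ C']) blast
  qed
  moreover have "eventually P (filter_mult m F (filter_mult m G H)) \<longleftrightarrow> ?Q P" for P
  proof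
    assume "eventually P (filter_mult m F (filter_mult m G H))"
    then show "?Q P" unfolding eventually_filter_mult by blast
  next
    assume "?Q P"
    then obtain A B C where *: "eventually A F" "eventually B G" "eventually C H"
      "\<And>x y z. A x \<Longrightarrow> B y \<Longrightarrow> C z \<Longrightarrow> P (m x (m y z))" by blast
    show "eventually P (filter_mult m F (filter_mult m G H))"
      unfolding eventually_filter_mult
      by (rule exI[of _ A], rule exI[of _ "\<lambda>w. \<exists>y z. B y \<and> C z \<and> w = m y z"]) (use * in blast)
  qed
  ultimately show ?thesis by (simp add: filter_eq_iff)
qed

text \<open>The filters in \<open>Y\<close> carry the topology with base \<open>{F \<in> Y. eventually P F}\<close>, in which the
  principal filters form a discrete dense copy of \<open>X\<close>. The assumption \<open>dec\<close> makes this base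
  contain one of clopen sets.\<close>
lemma filter_extension_not_closed:
  fixes \<C> :: "'b topsemigroup set"
  assumes TzS: "TzS \<subseteq> \<C>"
    and card: "Y \<lesssim> (UNIV :: 'b set)"
    and Y: "Y \<subseteq> filters_on X"
    and prin: "\<And>x. x \<in> X \<Longrightarrow> principal {x} \<in> Y"
    and mult: "\<And>F G. F \<in> Y \<Longrightarrow> G \<in> Y \<Longrightarrow> filter_mult m F G \<in> Y"
    and dec: "\<And>F P. F \<in> Y \<Longrightarrow> eventually P F \<Longrightarrow> \<exists>Q. eventually Q F \<and> (\<forall>x. Q x \<longrightarrow> P x) \<and>
                (\<forall>G\<in>Y. eventually Q G \<or> eventually (\<lambda>x. \<not> Q x) G)"
    and F0: "F0 \<in> Y" "\<And>x. x \<in> X \<Longrightarrow> F0 \<noteq> principal {x}"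
  shows "\<not> closed_semigroup \<C> X m"
proof
  assume closed: "closed_semigroup \<C> X m"
  obtain i :: "'a filter \<Rightarrow> 'b" where i: "inj_on i Y"
    using card by (auto simp: lepoll_def)
  define j where "j = inv_into Y i"
  have ji [simp]: "j (i F) = F" if "F \<in> Y" for F
    using that i by (simp add: j_def)
  have i_eq [simp]: "i F = i G \<longleftrightarrow> F = G" if "F \<in> Y" "G \<in> Y" for F G
    using that i by (auto dest: inj_onD)
  have not_both: False if "F \<in> Y" "eventually P F" "eventually (\<lambda>x. \<not> P x) F" for F P
    using that eventually_conj[OF that(2,3)] Y by (auto simp: filters_on_def trivial_limit_def)
  define N where "N P = i ` {F \<in> Y. eventually P F}" for P
  have N_iff [simp]: "i F \<in> N P \<longleftrightarrow> eventually P F" if "F \<in> Y" for F P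
    using that by (auto simp: N_def)
  have N_sub: "N P \<subseteq> i ` Y" for P by (auto simp: N_def)
  define op where "op U \<longleftrightarrow> U \<subseteq> i ` Y \<and> (\<forall>F\<in>Y. i F \<in> U \<longrightarrow> (\<exists>P. eventually P F \<and> N P \<subseteq> U))" for U
  have "istopology op"
    unfolding istopology_def
  proof (intro conjI allI impI)
    fix S T assume S: "op S" and T: "op T"
    show "op (S \<inter> T)"
      unfolding op_def
    proof (intro conjI ballI impI)
      show "S \<inter> T \<subseteq> i ` Y" using S by (auto simp: op_def)
      fix F assume F: "F \<in> Y" "i F \<in> S \<inter> T"
      obtain P Q where "eventually P F" "N P \<subseteq> S" "eventually Q F" "N Q \<subseteq> T"
        using S T F unfolding op_def by blast
      then show "\<exists>P. eventually P F \<and> N P \<subseteq> S \<inter> T"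
        by (intro exI[of _ "\<lambda>x. P x \<and> Q x"]) (auto simp: N_def eventually_conj_iff)
    qed
  next
    fix K assume "\<forall>S\<in>K. op S"
    then show "op (\<Union>K)" unfolding op_def by (meson UnionE Union_least Union_upper subset_trans)
  qed
  define S where "S = topology op"
  have openS: "openin S U \<longleftrightarrow> op U" for U
    using \<open>istopology op\<close> by (simp add: S_def)
  have openN: "openin S (N P)" for P
    unfolding openS op_def using N_sub by auto
  have top: "topspace S = i ` Y"
  proof
    show "topspace S \<subseteq> i ` Y" using openS[of "topspace S"] by (auto simp: op_def)
    have "N (\<lambda>_. True) = i ` Y" by (auto simp: N_def)
    then show "i ` Y \<subseteq> topspace S" using openN openin_subset by metis
  qed
  define n where "n u v = i (filter_mult m (j u) (j v))" for u v
  have n_i [simp]: "n (i F) (i G) = i (filter_mult m F G)" if "F \<in> Y" "G \<in> Y" for F G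
    using that by (simp add: n_def)
  have sg: "is_semigroup (topspace S) n"
    unfolding is_semigroup_def top using Y
    by (auto simp: mult subset_iff intro!: arg_cong[of _ _ i] filter_mult_assoc)
  have cont: "continuous_map (prod_topology S S) S (\<lambda>(x, y). n x y)"
    unfolding continuous_map
  proof (intro conjI allI impI)
    show "(\<lambda>(x, y). n x y) ` topspace (prod_topology S S) \<subseteq> topspace S"
      by (auto simp: top mult)
    fix U assume U: "openin S U"
    show "openin (prod_topology S S) {z \<in> topspace (prod_topology S S). (\<lambda>(x, y). n x y) z \<in> U}"
      unfolding openin_prod_topology_alt
    proof (intro allI impI)
      fix u v assume "(u, v) \<in> {z \<in> topspace (prod_topology S S). (\<lambda>(x, y). n x y) z \<in> U}"
      then obtain F G where FG: "F \<in> Y" "G \<in> Y" "u = i F" "v = i G" "i (filter_mult m F G) \<in> U"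
        by (auto simp: top)
      then obtain P where P: "eventually P (filter_mult m F G)" "N P \<subseteq> U"
        using U mult unfolding openS op_def by blast
      then obtain A B where AB: "eventually A F" "eventually B G" "\<And>x y. A x \<Longrightarrow> B y \<Longrightarrow> P (m x y)"
        unfolding eventually_filter_mult by blast
      have "n s t \<in> U" if st: "s \<in> N A" "t \<in> N B" for s t
      proof -
        obtain F' G' where F'G': "F' \<in> Y" "G' \<in> Y" "s = i F'" "t = i G'" "eventually A F'" "eventually B G'"
          using st by (auto simp: N_def)
        then have "eventually P (filter_mult m F' G')"
          unfolding eventually_filter_mult using AB(3) by blast
        then show ?thesis using P(2) F'G' mult by auto
      qed
      then have "N A \<times> N B \<subseteq> {z \<in> topspace (prod_topology S S). (\<lambda>(x, y). n x y) z \<in> U}"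
        using N_sub by (fastforce simp: top)
      then show "\<exists>U' V'. openin S U' \<and> openin S V' \<and> u \<in> U' \<and> v \<in> V' \<and>
          U' \<times> V' \<subseteq> {z \<in> topspace (prod_topology S S). (\<lambda>(x, y). n x y) z \<in> U}"
        using openN AB FG by (intro exI[of _ "N A"] exI[of _ "N B"]) auto
    qed
  qed
  define clop where "clop Q \<longleftrightarrow> (\<forall>G\<in>Y. eventually Q G \<or> eventually (\<lambda>x. \<not> Q x) G)" for Q
  have N_compl: "topspace S - N Q = N (\<lambda>x. \<not> Q x)" if "clop Q" for Q
    using that not_both unfolding top N_def clop_def by auto
  have "Hausdorff_space S"
    unfolding Hausdorff_space_def
  proof (intro allI impI)
    fix u v assume "u \<in> topspace S \<and> v \<in> topspace S \<and> u \<noteq> v"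
    then obtain F G where FG: "F \<in> Y" "G \<in> Y" "u = i F" "v = i G" "F \<noteq> G" by (auto simp: top)
    have sep: "\<exists>U V. openin S U \<and> openin S V \<and> i F \<in> U \<and> i G \<in> V \<and> disjnt U V"
      if "F \<in> Y" "G \<in> Y" "eventually P F" "\<not> eventually P G" for F G P
    proof -
      obtain Q where Q: "eventually Q F" "\<forall>x. Q x \<longrightarrow> P x" "clop Q"
        using dec[OF \<open>F \<in> Y\<close> \<open>eventually P F\<close>] unfolding clop_def by blast
      then have "\<not> eventually Q G" using \<open>\<not> eventually P G\<close> by (blast intro: eventually_mono)
      then show ?thesis
        using Q that openN N_compl[OF \<open>clop Q\<close>]
        by (intro exI[of _ "N Q"] exI[of _ "N (\<lambda>x. \<not> Q x)"]) (auto simp: clop_def disjnt_def)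
    qed
    obtain P where "eventually P F \<noteq> eventually P G" using FG by (auto simp: filter_eq_iff)
    then show "\<exists>U V. openin S U \<and> openin S V \<and> u \<in> U \<and> v \<in> V \<and> disjnt U V"
      using sep[of F G P] sep[of G F P] FG by (metis disjnt_sym)
  qed
  moreover have "zero_dimensional_space S"
    unfolding zero_dimensional_space_def
  proof (intro exI[of _ "N ` Collect clop"] conjI ballI allI impI)
    fix V assume "V \<in> N ` Collect clop"
    then obtain Q where Q: "V = N Q" "clop Q" by blast
    then show "openin S V" using openN by simp
    show "closedin S V"
      unfolding closedin_def using Q openN N_compl N_sub by (metis top)
  next
    fix U x assume U: "openin S U \<and> x \<in> U"
    then obtain F where F: "F \<in> Y" "x = i F" using openin_subset top by blast
    then obtain P where P: "eventually P F" "N P \<subseteq> U" using U unfolding openS op_def by blast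
    then obtain Q where Q: "eventually Q F" "\<forall>x. Q x \<longrightarrow> P x" "clop Q"
      using dec[OF F(1) P(1)] unfolding clop_def by blast
    then have "eventually P G" if "eventually Q G" for G
      using that by (blast intro: eventually_mono)
    then have "N Q \<subseteq> N P" by (auto simp: N_def)
    then show "\<exists>V\<in>N ` Collect clop. x \<in> V \<and> V \<subseteq> U"
      using F P(2) Q by (intro bexI[of _ "N Q"]) auto
  qed
  ultimately have "(S, n) \<in> \<C>"
    using TzS sg cont by (auto simp: TzS_def topological_semigroup_def)
  define h where "h x = i (principal {x})" for x
  have "semigroup_hom X m (topspace S) n h"
    by (auto simp: semigroup_hom_def h_def top prin)
  moreover have "embedding_map (discrete_topology X) S h"
  proof (rule injective_open_imp_embedding_map)
    show "continuous_map (discrete_topology X) S h"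
      by (auto simp: h_def top prin)
    show "inj_on h (topspace (discrete_topology X))"
      by (auto simp: inj_on_def h_def prin)
    have "openin S {h x}" if "x \<in> X" for x
    proof -
      have "F = principal {x}" if "F \<in> Y" "eventually (\<lambda>y. y = x) F" for F
        using that Y by (intro proper_filter_le_principal_singleton)
          (auto simp: filters_on_def le_principal)
      then have "{F \<in> Y. eventually (\<lambda>y. y = x) F} = {principal {x}}"
        using prin[OF that] eventually_principal[of "\<lambda>y. y = x" "{x}"] by blast
      then have "{h x} = N (\<lambda>y. y = x)"
        by (simp add: h_def N_def)
      then show ?thesis using openN by simp
    qed
    then have "openin S (h ` U)" if "U \<subseteq> X" for U
      using that openin_Union[of "(\<lambda>x. {h x}) ` U" S] by (auto simp: UNION_singleton_eq_range)
    then show "open_map (discrete_topology X) S h" by (simp add: open_map_def)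
  qed
  ultimately have "closedin S (h ` X)"
    using closed \<open>(S, n) \<in> \<C>\<close> unfolding closed_semigroup_def closed_topsemigroup_def by auto
  then have "openin S (topspace S - h ` X)" by (simp add: closedin_def)
  moreover have "i F0 \<in> topspace S - h ` X"
    using F0 prin by (auto simp: top h_def)
  ultimately obtain P where P: "eventually P F0" "N P \<subseteq> topspace S - h ` X"
    using F0(1) unfolding openS op_def by blast
  have "eventually (\<lambda>x. P x \<and> x \<in> X) F0"
    using P(1) F0(1) Y by (auto simp: filters_on_def eventually_conj_iff)
  then obtain x where "P x" "x \<in> X"
    using F0(1) Y eventually_happens' unfolding filters_on_def by blast
  then have "h x \<in> N P" using prin by (simp add: h_def eventually_principal)
  then show False using P(2) \<open>x \<in> X\<close> by auto
qed

end

section \<open>Ultrafilters and singular semigroups\<close>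

lemma times_nat_lepoll_infinite:
  assumes "infinite A" shows "A \<times> (UNIV :: nat set) \<lesssim> A"
proof -
  have "A \<times> (UNIV :: nat set) \<lesssim> A \<times> A"
    using assms by (intro times_lepoll_mono) (auto simp: infinite_le_lepoll)
  also have "A \<times> A \<approx> A"
    using card_of_Times_same_infinite[OF assms] by (simp add: eqpoll_iff_card_of_ordIso)
  finally show ?thesis .
qed

lemma Un_lepoll_infinite:
  assumes "infinite X" "A \<lesssim> X" "B \<lesssim> X" shows "A \<union> B \<lesssim> X"
proof -
  obtain f g where fg: "A \<subseteq> f ` X" "B \<subseteq> g ` X" using assms(2,3) by (auto simp: lepoll_iff)
  define h where "h = (\<lambda>(x, k :: nat). if k = 0 then f x else g x)"
  have "f x \<in> h ` (X \<times> UNIV)" "g x \<in> h ` (X \<times> UNIV)" if "x \<in> X" for x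
    using that imageI[of "(x, 0)" "X \<times> UNIV" h] imageI[of "(x, 1)" "X \<times> UNIV" h]
    by (simp_all add: h_def)
  with fg have "A \<union> B \<subseteq> h ` (X \<times> UNIV)" by blast
  then show ?thesis
    using lepoll_trans[OF subset_image_lepoll times_nat_lepoll_infinite[OF assms(1)]] by blast
qed

definition ultra_filter :: "'a filter \<Rightarrow> bool" where
  "ultra_filter F \<longleftrightarrow> F \<noteq> bot \<and> (\<forall>P. eventually P F \<or> eventually (\<lambda>x. \<not> P x) F)"

lemma ultra_filter_filtermap: "ultra_filter F \<Longrightarrow> ultra_filter (filtermap f F)"
  by (simp add: ultra_filter_def filtermap_bot_iff eventually_filtermap)

lemma ultra_filter_principal: "ultra_filter (principal {x})"
  by (simp add: ultra_filter_def principal_eq_bot_iff eventually_principal)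

lemma exists_ultra_filter_le:
  fixes F :: "'a filter"
  assumes "F \<noteq> bot"
  obtains U where "ultra_filter U" "U \<le> F"
proof -
  define A where "A = {G. G \<noteq> bot \<and> G \<le> F}"
  have "\<exists>U\<in>A. \<forall>G\<in>A. U \<ge> G \<longrightarrow> G = U"
  proof (rule predicate_Zorn)
    show "partial_order_on A (relation_of (\<ge>) A)"
      by (rule partial_order_on_relation_ofI) auto
    fix C assume C: "C \<in> Chains (relation_of (\<ge>) A)"
    then have tot: "G \<le> H \<or> H \<le> G" if "G \<in> C" "H \<in> C" for G H
      using that by (auto simp: Chains_def relation_of_def)
    show "\<exists>u\<in>A. \<forall>a\<in>C. a \<ge> u"
    proof (cases "C = {}")
      case True
      then show ?thesis using assms by (auto simp: A_def)
    next
      case False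
      have CA: "C \<subseteq> A" using C by (auto simp: Chains_def relation_of_def)
      have ev: "eventually P (Inf C) \<longleftrightarrow> (\<exists>b\<in>C. eventually P b)" for P
        by (rule eventually_Inf_base[OF False]) (metis inf.absorb1 inf.absorb2 order_refl tot)
      have "Inf C \<noteq> bot"
        using CA unfolding trivial_limit_def ev by (auto simp: A_def trivial_limit_def)
      moreover have "Inf C \<le> F"
        using CA False by (metis A_def Inf_lower2 equals0I mem_Collect_eq subsetD)
      ultimately show ?thesis by (auto simp: A_def intro: Inf_lower)
    qed
  qed
  then obtain U where U: "U \<in> A" "\<And>G. G \<in> A \<Longrightarrow> G \<le> U \<Longrightarrow> G = U" by blast
  have "eventually P U \<or> eventually (\<lambda>x. \<not> P x) U" for P
  proof (rule disjCI)
    assume "\<not> eventually (\<lambda>x. \<not> P x) U"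
    then have "inf U (principal {x. P x}) \<noteq> bot"
      by (simp add: trivial_limit_def eventually_inf_principal)
    then have "inf U (principal {x. P x}) = U"
      using U(1) by (intro U(2)) (auto simp: A_def intro: le_infI1)
    moreover have "eventually P (inf U (principal {x. P x}))"
      by (simp add: eventually_inf_principal)
    ultimately show "eventually P U" by simp
  qed
  with U(1) show ?thesis by (intro that[of U]) (auto simp: ultra_filter_def A_def)
qed

locale carrier_comm_semigroup = carrier_semigroup +
  assumes commutative: "is_commutative X m"
begin

lemma comm: "x \<in> X \<Longrightarrow> y \<in> X \<Longrightarrow> m x y = m y x"
  using commutative by (simp add: is_commutative_def)

lemma left_comm: "x \<in> X \<Longrightarrow> y \<in> X \<Longrightarrow> z \<in> X \<Longrightarrow> m x (m y z) = m y (m x z)"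
  by (metis assoc comm)

lemma interchange:
  "a \<in> X \<Longrightarrow> b \<in> X \<Longrightarrow> c \<in> X \<Longrightarrow> d \<in> X \<Longrightarrow> m (m a b) (m c d) = m (m a c) (m b d)"
  by (simp add: assoc left_comm)

lemma filter_mult_comm_le:
  assumes "F \<in> filters_on X" "G \<in> filters_on X"
  shows "filter_mult m F G \<le> filter_mult m G F"
proof (rule filter_leI)
  fix P assume "eventually P (filter_mult m G F)"
  then obtain Q R where *: "eventually Q G" "eventually R F" "\<And>x y. Q x \<Longrightarrow> R y \<Longrightarrow> P (m x y)"
    unfolding eventually_filter_mult by blast
  then have "eventually (\<lambda>x. Q x \<and> x \<in> X) G" "eventually (\<lambda>x. R x \<and> x \<in> X) F"
    using assms by (auto simp: filters_on_def eventually_conj_iff)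
  moreover have "\<forall>x y. R x \<and> x \<in> X \<longrightarrow> Q y \<and> y \<in> X \<longrightarrow> P (m x y)"
    using *(3) comm by metis
  ultimately show "eventually P (filter_mult m F G)"
    unfolding eventually_filter_mult by blast
qed

lemma filter_mult_comm:
  "F \<in> filters_on X \<Longrightarrow> G \<in> filters_on X \<Longrightarrow> filter_mult m F G = filter_mult m G F"
  by (intro antisym filter_mult_comm_le)

lemma filter_mult_interchange:
  assumes "F \<in> filters_on X" "G \<in> filters_on X" "H \<in> filters_on X" "K \<in> filters_on X"
  shows "filter_mult m (filter_mult m F G) (filter_mult m H K)
       = filter_mult m (filter_mult m F H) (filter_mult m G K)"
  using assms by (metis filter_mult_assoc filter_mult_closed filter_mult_comm)

text \<open>If \<open>AA = {c}\<close>, a free ultrafilter \<open>U\<close> on \<open>A\<close> satisfies \<open>U * U = c\<close>, so that \<open>X\<close> together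
  with \<open>U\<close> and its translates is closed under products; all its members are ultrafilters.\<close>
lemma singular_not_closed:
  fixes \<C> :: "'b topsemigroup set"
  assumes TzS: "TzS \<subseteq> \<C>" and card: "X \<lesssim> (UNIV :: 'b set)" and "singular X m"
  shows "\<not> closed_semigroup \<C> X m"
proof -
  obtain A c where A: "A \<subseteq> X" "infinite A" and AA: "{m a b | a b. a \<in> A \<and> b \<in> A} = {c}"
    using \<open>singular X m\<close> unfolding singular_def by blast
  have mA: "m a b = c" if "a \<in> A" "b \<in> A" for a b
    using AA that by blast
  obtain a0 where a0: "a0 \<in> A" using A(2) by (metis finite.emptyI ex_in_conv)
  have "infinite X" using A finite_subset by blast
  have cX: "c \<in> X" using mA[OF a0 a0] a0 A(1) by auto
  have "inf cofinite (principal A) \<noteq> bot"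
    using A(2) by (simp add: trivial_limit_def eventually_inf_principal eventually_cofinite)
  then obtain U where ultraU: "ultra_filter U" and U: "U \<le> inf cofinite (principal A)"
    by (rule exists_ultra_filter_le)
  have UA: "eventually (\<lambda>x. x \<in> A) U" using U by (simp add: le_principal)
  have U_on: "U \<in> filters_on X"
    using ultraU UA A(1) by (auto simp: filters_on_def ultra_filter_def elim: eventually_mono)
  have "filter_mult m U U \<le> principal {c}"
    unfolding le_principal eventually_filter_mult using UA mA by fastforce
  then have UU: "filter_mult m U U = principal {c}"
    using filter_mult_closed[OF U_on U_on]
    by (intro proper_filter_le_principal_singleton) (auto simp: filters_on_def)
  define t where "t x = filter_mult m (principal {x}) U" for x
  have t_on: "t x \<in> filters_on X" if "x \<in> X" for x
    using that U_on by (simp add: t_def filter_mult_closed principal_in_filters_on)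
  define Y where "Y = (\<lambda>x. principal {x}) ` X \<union> ({U} \<union> t ` X)"
  have Yon: "Y \<subseteq> filters_on X"
    using U_on t_on principal_in_filters_on by (auto simp: Y_def)
  have ultraY: "ultra_filter F" if "F \<in> Y" for F
    using that ultraU
    by (auto simp: Y_def t_def filter_mult_principal_left ultra_filter_principal ultra_filter_filtermap)
  have xt: "filter_mult m (principal {x}) (t y) = t (m x y)" if "x \<in> X" "y \<in> X" for x y
    unfolding t_def
    using that U_on by (simp add: filter_mult_assoc[symmetric] principal_in_filters_on)
  have Ut: "filter_mult m U (t y) = principal {m y c}" if "y \<in> X" for y
    using that U_on UU filter_mult_comm[OF U_on t_on[OF that]]
    by (simp add: t_def filter_mult_assoc principal_in_filters_on)
  have tt: "filter_mult m (t x) (t y) = principal {m (m x y) c}" if "x \<in> X" "y \<in> X" for x y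
    using that U_on UU unfolding t_def
    by (subst filter_mult_interchange) (simp_all add: principal_in_filters_on)
  have "filter_mult m F G \<in> Y \<and> filter_mult m G F \<in> Y" if FG: "F \<in> Y" "G \<in> Y" for F G
  proof -
    have "filter_mult m F G \<in> Y \<or> filter_mult m G F \<in> Y"
      using FG cX UU tt Ut xt unfolding Y_def by (auto simp flip: t_def)
    moreover have "filter_mult m F G = filter_mult m G F"
      using FG Yon filter_mult_comm by blast
    ultimately show ?thesis by simp
  qed
  then have mult: "\<And>F G. F \<in> Y \<Longrightarrow> G \<in> Y \<Longrightarrow> filter_mult m F G \<in> Y" by blast
  have "Y \<lesssim> X"
    unfolding Y_def
    by (intro Un_lepoll_infinite image_lepoll finite_lepoll_infinite \<open>infinite X\<close>) simp
  also note card
  finally have cardY: "Y \<lesssim> (UNIV :: 'b set)" .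
  show ?thesis
  proof (rule filter_extension_not_closed[OF TzS cardY Yon])
    show "principal {x} \<in> Y" if "x \<in> X" for x using that by (simp add: Y_def)
    show "filter_mult m F G \<in> Y" if "F \<in> Y" "G \<in> Y" for F G using that by (rule mult)
    show "\<exists>Q. eventually Q F \<and> (\<forall>x. Q x \<longrightarrow> P x) \<and>
        (\<forall>G\<in>Y. eventually Q G \<or> eventually (\<lambda>x. \<not> Q x) G)" if "F \<in> Y" "eventually P F" for F P
      using that ultraY by (intro exI[of _ P]) (auto simp: ultra_filter_def)
    show "U \<in> Y" by (simp add: Y_def)
    fix x assume "x \<in> X"
    have "eventually (\<lambda>y. y \<noteq> x) U"
      using U filter_leD[of U cofinite] by (simp add: eventually_cofinite)
    then show "U \<noteq> principal {x}" by (auto simp: eventually_principal)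
  qed
qed

end

section \<open>Powers and filters with a countable base\<close>

context carrier_semigroup
begin

abbreviation pw :: "'a \<Rightarrow> nat \<Rightarrow> 'a" where "pw \<equiv> semigroup_power m"

lemma pw_1 [simp]: "pw x (Suc 0) = x"
  by (simp add: semigroup_power_def)

lemma pw_Suc: "n \<ge> 1 \<Longrightarrow> pw x (Suc n) = m x (pw x n)"
  by (cases n) (simp_all add: semigroup_power_def)

lemma pw_closed [simp, intro]: "x \<in> X \<Longrightarrow> pw x n \<in> X"
proof -
  assume x: "x \<in> X"
  have "(m x ^^ k) x \<in> X" for k using x by (induction k) auto
  then show ?thesis by (simp add: semigroup_power_def)
qed

lemma pw_add:
  assumes "x \<in> X" "i \<ge> 1" "j \<ge> 1" shows "pw x (i + j) = m (pw x i) (pw x j)"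
  using assms(2) by (induction i rule: nat_induct_at_least) (use assms in \<open>simp_all add: pw_Suc assoc\<close>)

lemma pw_mult:
  assumes "x \<in> X" "i \<ge> 1" "j \<ge> 1" shows "pw x (i * j) = pw (pw x i) j"
  using assms(3)
  by (induction j rule: nat_induct_at_least) (use assms in \<open>simp_all add: pw_Suc pw_add\<close>)

lemma pw_idempotent: "m e e = e \<Longrightarrow> pw e n = e"
proof -
  assume "m e e = e"
  then have "(m e ^^ k) e = e" for k by (induction k) auto
  then show ?thesis by (simp add: semigroup_power_def)
qed

lemma pw_eq_periodic:
  assumes "x \<in> X" "1 \<le> i" "i < j" "pw x i = pw x j" "i \<le> k"
  shows "pw x (k + l * (j - i)) = pw x k"
proof -
  have step: "pw x (k + (j - i)) = pw x k" if "i \<le> k" for k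
  proof (cases "k = i")
    case False
    have "k + (j - i) = j + (k - i)" using assms(3) that by simp
    then have "pw x (k + (j - i)) = m (pw x j) (pw x (k - i))" "pw x k = m (pw x i) (pw x (k - i))"
      using assms(1,2,3) that False pw_add[of x j "k - i"] pw_add[of x i "k - i"] by simp_all
    then show ?thesis using assms(4) by simp
  qed (use assms in simp)
  show ?thesis
  proof (induction l)
    case (Suc l)
    then show ?case using step[of "k + l * (j - i)"] assms(5) by (simp add: ac_simps)
  qed simp
qed

lemma pw_eq_idempotent:
  assumes "x \<in> X" "1 \<le> i" "i < j" "pw x i = pw x j"
  shows "Defs.idempotent m (pw x (i * (j - i)))"
proof -
  have "pw x (i * (j - i) + i * (j - i)) = pw x (i * (j - i))"
    using assms by (intro pw_eq_periodic) auto
  then show ?thesis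
    using assms pw_add[of x "i * (j - i)" "i * (j - i)"] by (simp add: Defs.idempotent_def)
qed

end

lemma (in carrier_comm_semigroup) pw_distrib:
  assumes "x \<in> X" "y \<in> X" "n \<ge> 1" shows "pw (m x y) n = m (pw x n) (pw y n)"
  using assms(3)
  by (induction n rule: nat_induct_at_least) (use assms in \<open>simp_all add: pw_Suc interchange\<close>)

definition base_filter :: "(nat \<Rightarrow> 'a set) \<Rightarrow> 'a filter" where
  "base_filter B = (INF n. principal (B n))"

lemma eventually_base_filter:
  assumes "antimono B"
  shows "eventually P (base_filter B) \<longleftrightarrow> (\<exists>n. \<forall>x\<in>B n. P x)"
  unfolding base_filter_def
proof (subst eventually_INF_base)
  fix a b :: nat
  show "\<exists>x\<in>UNIV. principal (B x) \<le> inf (principal (B a)) (principal (B b))"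
    using antimonoD[OF assms, of a "max a b"] antimonoD[OF assms, of b "max a b"]
    by (intro bexI[of _ "max a b"]) auto
qed (auto simp: eventually_principal)

context carrier_semigroup
begin

lemma filter_mult_base_filter:
  assumes "antimono B" "antimono C" "antimono D"
    and "\<And>n. \<exists>k. D k \<subseteq> {m x y | x y. x \<in> B n \<and> y \<in> C n}"
    and "\<And>n. \<exists>k. {m x y | x y. x \<in> B k \<and> y \<in> C k} \<subseteq> D n"
  shows "filter_mult m (base_filter B) (base_filter C) = base_filter D"
proof -
  have "eventually P (filter_mult m (base_filter B) (base_filter C)) \<longleftrightarrow>
    eventually P (base_filter D)" for P
  proof
    assume "eventually P (filter_mult m (base_filter B) (base_filter C))"
    then obtain Q R n k where "\<forall>x\<in>B n. Q x" "\<forall>y\<in>C k. R y" "\<forall>x y. Q x \<longrightarrow> R y \<longrightarrow> P (m x y)"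
      unfolding eventually_filter_mult eventually_base_filter[OF assms(1)]
        eventually_base_filter[OF assms(2)] by blast
    moreover have "B (max n k) \<subseteq> B n" "C (max n k) \<subseteq> C k"
      using antimonoD[OF assms(1), of n "max n k"] antimonoD[OF assms(2), of k "max n k"] by auto
    ultimately have *: "\<forall>x\<in>B (max n k). \<forall>y\<in>C (max n k). P (m x y)"
      by blast
    obtain l where l: "D l \<subseteq> {m x y | x y. x \<in> B (max n k) \<and> y \<in> C (max n k)}"
      using assms(4) by blast
    have "\<forall>z\<in>D l. P z"
    proof
      fix z assume "z \<in> D l"
      with l obtain x y where "z = m x y" "x \<in> B (max n k)" "y \<in> C (max n k)" by blast
      with * show "P z" by blast
    qed
    then show "eventually P (base_filter D)"
      unfolding eventually_base_filter[OF assms(3)] by blast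
  next
    assume "eventually P (base_filter D)"
    then obtain n where n: "\<forall>z\<in>D n. P z"
      unfolding eventually_base_filter[OF assms(3)] by blast
    obtain k where k: "{m x y | x y. x \<in> B k \<and> y \<in> C k} \<subseteq> D n"
      using assms(5) by blast
    have "eventually (\<lambda>x. x \<in> B k) (base_filter B)" "eventually (\<lambda>y. y \<in> C k) (base_filter C)"
      by (auto simp: eventually_base_filter assms(1,2))
    moreover have "\<forall>x y. x \<in> B k \<longrightarrow> y \<in> C k \<longrightarrow> P (m x y)" using n k by blast
    ultimately show "eventually P (filter_mult m (base_filter B) (base_filter C))"
      unfolding eventually_filter_mult by blast
  qed
  then show ?thesis by (simp add: filter_eq_iff)
qed

end

lemma (in carrier_comm_semigroup) base_filter_family_not_closed:
  fixes \<C> :: "'b topsemigroup set" and D :: "'i \<Rightarrow> nat \<Rightarrow> 'a set"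
  assumes TzS: "TzS \<subseteq> \<C>" and cardX: "X \<lesssim> (UNIV :: 'b set)"
    and cardI: "I \<lesssim> X \<times> (UNIV :: nat set)"
    and anti: "\<And>i. i \<in> I \<Longrightarrow> antimono (D i)"
    and DX: "\<And>i n. i \<in> I \<Longrightarrow> D i n \<subseteq> X"
    and ne: "\<And>i n. i \<in> I \<Longrightarrow> D i n \<noteq> {}"
    and mult: "\<And>i j. i \<in> I \<Longrightarrow> j \<in> I \<Longrightarrow> \<exists>k\<in>I.
      (\<forall>n. \<exists>l. D k l \<subseteq> {m x y | x y. x \<in> D i n \<and> y \<in> D j n}) \<and>
      (\<forall>n. \<exists>l. {m x y | x y. x \<in> D i l \<and> y \<in> D j l} \<subseteq> D k n)"
    and act: "\<And>x i. x \<in> X \<Longrightarrow> i \<in> I \<Longrightarrow> \<exists>k\<in>I. \<forall>n. D k n = m x ` D i n"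
    and dec: "\<And>i j n. i \<in> I \<Longrightarrow> j \<in> I \<Longrightarrow> \<exists>l. D j l \<subseteq> D i n \<or> D j l \<inter> D i n = {}"
    and dec1: "\<And>x j. x \<in> X \<Longrightarrow> j \<in> I \<Longrightarrow> \<exists>l. D j l \<subseteq> {x} \<or> x \<notin> D j l"
    and i0: "i0 \<in> I" "\<And>x n. \<not> D i0 n \<subseteq> {x}"
  shows "\<not> closed_semigroup \<C> X m"
proof -
  define \<phi> where "\<phi> i = base_filter (D i)" for i
  have ev: "eventually P (\<phi> i) \<longleftrightarrow> (\<exists>n. \<forall>x\<in>D i n. P x)" if "i \<in> I" for i P
    unfolding \<phi>_def by (rule eventually_base_filter[OF anti[OF that]])
  have \<phi>_on: "\<phi> i \<in> filters_on X" if "i \<in> I" for i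
    using that DX ne by (fastforce simp: filters_on_def trivial_limit_def ev)
  define Y where "Y = (\<lambda>x. principal {x}) ` X \<union> \<phi> ` I"
  have "infinite X"
  proof
    assume "finite X"
    have "\<forall>x\<in>X. eventually (\<lambda>y. y \<noteq> x) (\<phi> i0)"
    proof
      fix x assume "x \<in> X"
      then obtain l where "x \<notin> D i0 l" using dec1[of x i0] i0 by blast
      then show "eventually (\<lambda>y. y \<noteq> x) (\<phi> i0)" unfolding ev[OF i0(1)] by blast
    qed
    then have "eventually (\<lambda>y. \<forall>x\<in>X. y \<noteq> x) (\<phi> i0)"
      using \<open>finite X\<close> by (simp add: eventually_ball_finite)
    moreover have "eventually (\<lambda>y. y \<in> X) (\<phi> i0)" "\<phi> i0 \<noteq> bot"
      using \<phi>_on[OF i0(1)] by (auto simp: filters_on_def)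
    ultimately show False
      using eventually_happens'[OF \<open>\<phi> i0 \<noteq> bot\<close> eventually_conj] by blast
  qed
  have "\<phi> ` I \<lesssim> X"
    by (rule lepoll_trans[OF image_lepoll lepoll_trans[OF cardI]])
      (rule times_nat_lepoll_infinite[OF \<open>infinite X\<close>])
  then have "Y \<lesssim> X"
    unfolding Y_def by (intro Un_lepoll_infinite image_lepoll \<open>infinite X\<close>)
  also note cardX
  finally have cardY: "Y \<lesssim> (UNIV :: 'b set)" .
  have Yon: "Y \<subseteq> filters_on X"
    using \<phi>_on principal_in_filters_on by (auto simp: Y_def)
  have \<phi>\<phi>: "filter_mult m (\<phi> i) (\<phi> j) \<in> \<phi> ` I" if ij: "i \<in> I" "j \<in> I" for i j
  proof -
    obtain k where k: "k \<in> I" "\<And>n. \<exists>l. D k l \<subseteq> {m x y | x y. x \<in> D i n \<and> y \<in> D j n}"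
      "\<And>n. \<exists>l. {m x y | x y. x \<in> D i l \<and> y \<in> D j l} \<subseteq> D k n"
      using mult[OF ij] by blast
    have "filter_mult m (\<phi> i) (\<phi> j) = \<phi> k"
      unfolding \<phi>_def by (rule filter_mult_base_filter) (use k ij anti in auto)
    with k(1) show ?thesis by blast
  qed
  have x\<phi>: "filter_mult m (principal {x}) (\<phi> i) \<in> \<phi> ` I" if xi: "x \<in> X" "i \<in> I" for x i
  proof -
    obtain k where k: "k \<in> I" "\<And>n. D k n = m x ` D i n" using act[OF xi] by blast
    have "filtermap (m x) (\<phi> i) = \<phi> k"
      using k xi by (simp add: filter_eq_iff eventually_filtermap ev)
    with k(1) show ?thesis by (auto simp: filter_mult_principal_left)
  qed
  have \<phi>x: "filter_mult m (\<phi> i) (principal {x}) \<in> \<phi> ` I" if "x \<in> X" "i \<in> I" for x i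
    using x\<phi>[OF that] filter_mult_comm[of "\<phi> i" "principal {x}"] that \<phi>_on
    by (simp add: principal_in_filters_on)
  have dec_x: "eventually (\<lambda>y. y = x) G \<or> eventually (\<lambda>y. y \<noteq> x) G" if "x \<in> X" "G \<in> Y" for x G
  proof (cases "G \<in> \<phi> ` I")
    case True
    then obtain j where j: "j \<in> I" "G = \<phi> j" by blast
    obtain l where "D j l \<subseteq> {x} \<or> x \<notin> D j l" using dec1[OF \<open>x \<in> X\<close> j(1)] by blast
    then show ?thesis unfolding j(2) ev[OF j(1)] by blast
  next
    case False
    with that show ?thesis by (auto simp: Y_def eventually_principal)
  qed
  show ?thesis
  proof (rule filter_extension_not_closed[OF TzS cardY Yon])
    show "principal {x} \<in> Y" if "x \<in> X" for x using that by (simp add: Y_def)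
    show "filter_mult m F G \<in> Y" if "F \<in> Y" "G \<in> Y" for F G
      using that x\<phi> \<phi>x \<phi>\<phi> unfolding Y_def by auto
    show "\<exists>Q. eventually Q F \<and> (\<forall>x. Q x \<longrightarrow> P x) \<and>
        (\<forall>G\<in>Y. eventually Q G \<or> eventually (\<lambda>x. \<not> Q x) G)" if F: "F \<in> Y" "eventually P F" for F P
    proof (cases "F \<in> \<phi> ` I")
      case True
      then obtain i n where i: "i \<in> I" "F = \<phi> i" and n: "\<forall>x\<in>D i n. P x"
        using F ev by blast
      have "eventually (\<lambda>x. x \<in> D i n) G \<or> eventually (\<lambda>x. x \<notin> D i n) G" if "G \<in> Y" for G
      proof (cases "G \<in> \<phi> ` I")
        case True
        then obtain j where j: "j \<in> I" "G = \<phi> j" by blast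
        show ?thesis using dec[OF i(1) j(1), of n] unfolding j(2) ev[OF j(1)] by blast
      next
        case False
        with that show ?thesis by (auto simp: Y_def eventually_principal)
      qed
      moreover have "eventually (\<lambda>x. x \<in> D i n) F" unfolding i(2) ev[OF i(1)] by blast
      ultimately show ?thesis using n by blast
    next
      case False
      then obtain x where x: "x \<in> X" "F = principal {x}" using F by (auto simp: Y_def)
      then show ?thesis using F dec_x[OF x(1)]
        by (intro exI[of _ "\<lambda>y. y = x"]) (auto simp: eventually_principal)
    qed
    show "\<phi> i0 \<in> Y" using i0 by (simp add: Y_def)
    fix x assume "x \<in> X"
    have "\<not> eventually (\<lambda>y. y = x) (\<phi> i0)" using i0 by (auto simp: ev)
    then show "\<phi> i0 \<noteq> principal {x}" by (auto simp: eventually_principal)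
  qed
qed

text \<open>The filter of the sets \<open>{y^j | j \<ge> n, n! dvd j}\<close> is idempotent; it plays the role of the
  identity of the profinite completion of the powers of \<open>y\<close>.\<close>
lemma (in carrier_comm_semigroup) nonperiodic_not_closed:
  fixes \<C> :: "'b topsemigroup set"
  assumes TzS: "TzS \<subseteq> \<C>" and cardX: "X \<lesssim> (UNIV :: 'b set)"
    and y: "y \<in> X" "\<And>n. n \<ge> 1 \<Longrightarrow> \<not> Defs.idempotent m (pw y n)"
  shows "\<not> closed_semigroup \<C> X m"
proof -
  define J where "J n = {j. n \<le> j \<and> 1 \<le> j \<and> fact n dvd j}" for n :: nat
  define D where "D a n = (\<lambda>j. m a (pw y j)) ` J n" for a n
  have J_anti: "J k \<subseteq> J n" if "n \<le> k" for n k
    using that fact_dvd[of n k] unfolding J_def by (auto intro: dvd_trans)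
  have J_ne: "fact n * Suc n * Suc i \<in> J n" for n i
  proof -
    have "n * 1 * 1 \<le> Suc n * Suc i * fact n" by (intro mult_le_mono) simp_all
    then have "n \<le> fact n * Suc n * Suc i" by (simp only: mult_1_right ac_simps)
    moreover have "0 < fact n * Suc n * Suc i" by (intro mult_pos_pos) simp_all
    ultimately show ?thesis
      by (simp only: J_def mem_Collect_eq dvd_triv_left mult.assoc simp_thms less_eq_Suc_le One_nat_def)
  qed
  have J_add: "i + j \<in> J n" if "i \<in> J n" "j \<in> J n" for i j n
    using that by (auto simp: J_def)
  have pwJ: "pw y (i + j) = m (pw y i) (pw y j)" if "i \<in> J n" "j \<in> J k" for i j n k
    using that y by (auto simp: J_def pw_add)
  have mpw: "m a (pw y (i + j)) = m (m a (pw y i)) (pw y j)" if "a \<in> X" "1 \<le> i" "1 \<le> j" for a i j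
    using that y by (simp add: pw_add assoc)
  have pw_inj: "pw y i \<noteq> pw y j" if "1 \<le> i" "i < j" for i j
    using pw_eq_idempotent[OF y(1) that] y(2)[of "i * (j - i)"] that by auto
  show ?thesis
  proof (rule base_filter_family_not_closed[OF TzS cardX, of X D])
    show "X \<lesssim> X \<times> (UNIV :: nat set)"
      by (rule subset_image_lepoll[of _ fst]) (force simp: image_iff)
    show "antimono (D i)" for i
      using J_anti unfolding D_def by (intro antimonoI image_mono) auto
    show "D i n \<subseteq> X" if "i \<in> X" for i n using that y by (auto simp: D_def)
    show "D i n \<noteq> {}" for i n using J_ne by (auto simp: D_def)
    show "\<exists>k\<in>X. (\<forall>n. \<exists>l. D k l \<subseteq> {m x y |x y. x \<in> D i n \<and> y \<in> D j n}) \<and>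
        (\<forall>n. \<exists>l. {m x y |x y. x \<in> D i l \<and> y \<in> D j l} \<subseteq> D k n)" if ij: "i \<in> X" "j \<in> X" for i j
    proof (intro bexI[of _ "m i j"] conjI allI)
      have split: "m (m i j) (pw y (s + t)) = m (m i (pw y s)) (m j (pw y t))"
        if "s \<in> J n" "t \<in> J n" for s t n
        using that ij y by (simp add: pwJ interchange)
      fix n
      define s where "s = fact n * Suc n * Suc 0"
      have s: "s \<in> J n" unfolding s_def by (rule J_ne)
      have "D (m i j) (2 * s) \<subseteq> {m x y |x y. x \<in> D i n \<and> y \<in> D j n}"
      proof
        fix z assume "z \<in> D (m i j) (2 * s)"
        then obtain t where t: "t \<in> J (2 * s)" "z = m (m i j) (pw y t)" by (auto simp: D_def)
        have "n \<le> s" "1 \<le> s" "fact n dvd s" using s by (auto simp: J_def)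
        then have "t - s \<in> J n"
          using t(1) fact_dvd[of n "2 * s"]
          by (auto simp: J_def intro!: dvd_diff_nat intro: dvd_trans)
        moreover have "t = s + (t - s)" using t(1) by (auto simp: J_def)
        ultimately show "z \<in> {m x y |x y. x \<in> D i n \<and> y \<in> D j n}"
          using split[of s n "t - s"] s t(2) unfolding D_def by auto
      qed
      then show "\<exists>l. D (m i j) l \<subseteq> {m x y |x y. x \<in> D i n \<and> y \<in> D j n}" by blast
      have "m (m i (pw y s)) (m j (pw y t)) \<in> D (m i j) n" if "s \<in> J n" "t \<in> J n" for s t
        using split[OF that] J_add[OF that] unfolding D_def by (metis imageI)
      then have "{m x y |x y. x \<in> D i n \<and> y \<in> D j n} \<subseteq> D (m i j) n"
        unfolding D_def by blast
      then show "\<exists>l. {m x y |x y. x \<in> D i l \<and> y \<in> D j l} \<subseteq> D (m i j) n" by blast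
    qed (use ij in simp)
    show "\<exists>k\<in>X. \<forall>n. D k n = m x ` D i n" if "x \<in> X" "i \<in> X" for x i
      using that y by (intro bexI[of _ "m x i"]) (auto simp: D_def image_image assoc)
    have shift: "D b (Suc t) \<subseteq> D a n"
      if ab: "a \<in> X" "b \<in> X" and s: "s \<in> J n" "t \<in> J n" "m a (pw y s) = m b (pw y t)" for a b s t n
    proof
      fix z assume "z \<in> D b (Suc t)"
      then obtain u where u: "u \<in> J (Suc t)" "z = m b (pw y u)" by (auto simp: D_def)
      have "n \<le> Suc t" using s by (auto simp: J_def)
      then have "u \<in> J n" using u J_anti by blast
      then have d: "fact n dvd u - t" "1 \<le> u - t" using s u by (auto simp: J_def)
      have "z = m b (pw y (t + (u - t)))" using u d by simp
      also have "\<dots> = m (m b (pw y t)) (pw y (u - t))"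
        using ab s d by (intro mpw) (auto simp: J_def)
      also have "\<dots> = m (m a (pw y s)) (pw y (u - t))" using s by simp
      also have "\<dots> = m a (pw y (s + (u - t)))"
        using ab s d by (intro mpw[symmetric]) (auto simp: J_def)
      finally have "z = m a (pw y (s + (u - t)))" .
      moreover have "fact n dvd s + (u - t)" using s d by (intro dvd_add) (auto simp: J_def)
      then have "s + (u - t) \<in> J n" using s by (auto simp: J_def)
      ultimately show "z \<in> D a n" unfolding D_def by blast
    qed
    show "\<exists>l. D j l \<subseteq> D i n \<or> D j l \<inter> D i n = {}" if ij: "i \<in> X" "j \<in> X" for i j n
    proof (cases "D j n \<inter> D i n = {}")
      case False
      then obtain s t where st: "s \<in> J n" "t \<in> J n" and "m j (pw y t) = m i (pw y s)"
        by (auto simp: D_def)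
      then show ?thesis using shift[OF ij st] by auto
    qed blast
    show "\<exists>l. D j l \<subseteq> {x} \<or> x \<notin> D j l" if xj: "x \<in> X" "j \<in> X" for x j
    proof (rule ccontr)
      assume contra: "\<nexists>l. D j l \<subseteq> {x} \<or> x \<notin> D j l"
      then obtain s where s: "s \<in> J 0" "x = m j (pw y s)" unfolding D_def by blast
      obtain t where t: "t \<in> J (Suc s)" "x = m j (pw y t)" using contra unfolding D_def by blast
      define r where "r = t - s"
      have r: "1 \<le> r" "1 \<le> s" "t = s + r" using s t by (auto simp: r_def J_def)
      have per: "m j (pw y (s + r * k)) = x" for k
      proof (induction k)
        case (Suc k)
        have "m j (pw y (s + r * Suc k)) = m j (pw y ((s + r * k) + r))" by (simp add: algebra_simps)
        also have "\<dots> = m (m j (pw y (s + r * k))) (pw y r)"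
          using r xj by (intro mpw) auto
        also have "\<dots> = m (m j (pw y s)) (pw y r)" using Suc s by simp
        also have "\<dots> = m j (pw y t)" unfolding r(3) using r xj by (intro mpw[symmetric]) auto
        finally show ?case using t by simp
      qed (use s in simp)
      obtain u where u: "u \<in> J (s + r)" "x = m j (pw y u)" using contra unfolding D_def by blast
      have "D j u \<subseteq> {x}"
      proof
        fix z assume "z \<in> D j u"
        then obtain v where v: "v \<in> J u" "z = m j (pw y v)" by (auto simp: D_def)
        have ru: "r dvd u" "s + r \<le> u" using u r dvd_fact[of r "s + r"] by (auto simp: J_def intro: dvd_trans)
        then have rv: "r dvd v" "u \<le> v" using v r dvd_fact[of r u] by (auto simp: J_def intro: dvd_trans)
        show "z \<in> {x}"
        proof (cases "u = v")
          case True then show ?thesis using u v by simp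
        next
          case False
          obtain k where k: "v - u = r * k" using ru rv by (metis dvd_def dvd_diff_nat)
          have vk: "v = u + r * k" "1 \<le> r * k" using rv False unfolding k[symmetric] by auto
          have "z = m (m j (pw y u)) (pw y (r * k))"
            unfolding v(2) vk(1) using r ru vk xj by (intro mpw) auto
          also have "\<dots> = m (m j (pw y s)) (pw y (r * k))" using u s by simp
          also have "\<dots> = m j (pw y (s + r * k))" using r vk xj by (intro mpw[symmetric]) auto
          finally show ?thesis using per by simp
        qed
      qed
      then show False using contra by blast
    qed
    show "y \<in> X" by (rule y)
    show "\<not> D y n \<subseteq> {x}" for n x
    proof
      assume "D y n \<subseteq> {x}"
      then have "m y (pw y (fact n * Suc n * Suc 0)) = m y (pw y (fact n * Suc n * Suc 1))"
        using J_ne[of n 0] J_ne[of n 1] unfolding D_def by blast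
      then have "pw y (Suc (fact n * Suc n * Suc 0)) = pw y (Suc (fact n * Suc n * Suc 1))"
        using J_ne[of n 0] J_ne[of n 1] by (subst (1 2) pw_Suc) (auto simp: J_def)
      then show False using pw_inj[of "Suc (fact n * Suc n * Suc 0)" "Suc (fact n * Suc n * Suc 1)"]
        by simp
    qed
  qed
qed

section \<open>Unbounded periodic groups\<close>

lemma (in monoid) nat_pow_eq_one_dvd:
  assumes "g \<in> carrier G" "g [^] a = \<one>" "a dvd b" shows "g [^] (b :: nat) = \<one>"
proof -
  obtain c where "b = a * c" using assms(3) by blast
  then show ?thesis using assms by (simp flip: nat_pow_pow)
qed

context comm_group
begin

definition list_prod :: "(nat \<Rightarrow> 'a) \<Rightarrow> nat list \<Rightarrow> 'a" where
  "list_prod x is = foldr (\<lambda>i. (\<otimes>) (x i)) is \<one>"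

lemma list_prod_Nil [simp]: "list_prod x [] = \<one>"
  and list_prod_Cons [simp]: "list_prod x (i # is) = x i \<otimes> list_prod x is"
  by (simp_all add: list_prod_def)

lemma list_prod_closed [simp, intro]: "range x \<subseteq> carrier G \<Longrightarrow> list_prod x is \<in> carrier G"
  by (induction "is") auto

lemma list_prod_append:
  "range x \<subseteq> carrier G \<Longrightarrow> list_prod x (is @ js) = list_prod x is \<otimes> list_prod x js"
  by (induction "is") (auto simp: m_assoc range_subsetD)

lemma list_prod_remove1:
  "range x \<subseteq> carrier G \<Longrightarrow> t \<in> set is \<Longrightarrow> list_prod x is = x t \<otimes> list_prod x (remove1 t is)"
  by (induction "is") (auto simp: m_lcomm range_subsetD)

lemma list_prod_pow:
  assumes x: "range x \<subseteq> carrier G" and "set is \<subseteq> {..t}" and "\<And>i. i < t \<Longrightarrow> x i [^] q = \<one>"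
  shows "list_prod x is [^] (q :: nat) = x t [^] (count_list is t * q)"
  using assms(2)
proof (induction "is")
  case (Cons i "is")
  have xi: "x i \<in> carrier G" for i using x by auto
  have "list_prod x (i # is) [^] q = x i [^] q \<otimes> x t [^] (count_list is t * q)"
    using Cons x xi by (simp add: nat_pow_distrib)
  then show ?case
    using Cons.prems assms(3)[of i] xi by (cases "i = t") (auto simp: nat_pow_mult)
qed simp

text \<open>Compare the largest index occurring on either side: raising to the power \<open>q t\<close> kills all
  smaller indices, so that it occurs on both sides and can be cancelled.\<close>
lemma list_prod_cancel:
  fixes q :: "nat \<Rightarrow> nat"
  assumes x: "range x \<subseteq> carrier G"
    and q_dvd: "\<And>i j. i \<le> j \<Longrightarrow> q i dvd q j"
    and kill: "\<And>i j. i < j \<Longrightarrow> x i [^] q j = \<one>"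
    and indep: "\<And>c n. 1 \<le> c \<Longrightarrow> c \<le> n \<Longrightarrow> x n [^] (c * q n) \<noteq> \<one>"
    and g: "g \<in> carrier G" "g [^] q M = \<one>"
  shows "set ms \<subseteq> {M..} \<Longrightarrow> length ms \<le> M \<Longrightarrow> length ns \<le> M \<Longrightarrow>
    g \<otimes> list_prod x ms = list_prod x ns \<Longrightarrow>
    \<exists>ns'. set ns' \<subseteq> set ns \<and> length ns' + length ms = length ns \<and> g = list_prod x ns'"
proof (induction "length ms" arbitrary: ms ns)
  case 0
  then show ?case using g x by (intro exI[of _ ns]) auto
next
  case (Suc k)
  define t where "t = Max (set ms \<union> set ns)"
  have "ms \<noteq> []" using Suc by auto
  then have t_in: "t \<in> set ms \<union> set ns" and le_t: "set ms \<subseteq> {..t}" "set ns \<subseteq> {..t}"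
    unfolding t_def using Max_in[of "set ms \<union> set ns"] Max_ge[of "set ms \<union> set ns"] by auto
  have "M \<le> t" using \<open>ms \<noteq> []\<close> le_t Suc.prems(1) by (cases ms) auto
  then have gt: "g [^] q t = \<one>"
    using q_dvd[of M t] g nat_pow_eq_one_dvd by blast
  have xi: "x i \<in> carrier G" for i using x by auto
  have pow_eq: "x t [^] (count_list ms t * q t) = x t [^] (count_list ns t * q t)"
  proof -
    have "x t [^] (count_list ms t * q t) = (g \<otimes> list_prod x ms) [^] q t"
      using gt g x xi list_prod_pow[OF x le_t(1), of "q t"] kill by (simp add: nat_pow_distrib)
    also have "\<dots> = x t [^] (count_list ns t * q t)"
      using Suc.prems(4) list_prod_pow[OF x le_t(2), of "q t"] kill by simp
    finally show ?thesis .
  qed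
  have count: "count_list ms t \<le> t" "count_list ns t \<le> t"
    using \<open>M \<le> t\<close> Suc.prems count_le_length[of ms t] count_le_length[of ns t] by auto
  have "t \<in> set ms \<and> t \<in> set ns"
  proof (rule ccontr)
    assume "\<not> (t \<in> set ms \<and> t \<in> set ns)"
    then consider "t \<in> set ms" "t \<notin> set ns" | "t \<notin> set ms" "t \<in> set ns" using t_in by blast
    then show False
    proof cases
      case 1
      then have "1 \<le> count_list ms t" "count_list ns t = 0"
        by (simp_all add: count_list_0_iff Suc_le_eq flip: neq0_conv)
      then show False using pow_eq indep[of "count_list ms t" t] count by simp
    next
      case 2
      then have "1 \<le> count_list ns t" "count_list ms t = 0"
        by (simp_all add: count_list_0_iff Suc_le_eq flip: neq0_conv)
      then show False using pow_eq indep[of "count_list ns t" t] count by simp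
    qed
  qed
  then have t: "t \<in> set ms" "t \<in> set ns" by auto
  have "x t \<otimes> (g \<otimes> list_prod x (remove1 t ms)) = x t \<otimes> list_prod x (remove1 t ns)"
    using Suc.prems(4) t x xi g by (simp add: list_prod_remove1 m_lcomm)
  then have "g \<otimes> list_prod x (remove1 t ms) = list_prod x (remove1 t ns)"
    using x xi g by simp
  moreover have "set (remove1 t ms) \<subseteq> {M..}" using Suc.prems(1) set_remove1_subset by fast
  moreover have "k = length (remove1 t ms)" "length (remove1 t ms) \<le> M" "length (remove1 t ns) \<le> M"
    using Suc.hyps(2) Suc.prems(2,3) t by (auto simp: length_remove1)
  ultimately obtain ns' where ns': "set ns' \<subseteq> set (remove1 t ns)"
    "length ns' + length (remove1 t ms) = length (remove1 t ns)" "g = list_prod x ns'"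
    using Suc.hyps(1)[of "remove1 t ms" "remove1 t ns"] by blast
  moreover have "length ns' + length ms = length ns"
  proof -
    have "length (remove1 t ms) = length ms - 1" "length (remove1 t ns) = length ns - 1"
      using t by (simp_all add: length_remove1)
    then show ?thesis
      using ns'(2) length_pos_if_in_set[OF t(1)] length_pos_if_in_set[OF t(2)] by linarith
  qed
  ultimately show ?case using set_remove1_subset by (metis subset_trans)
qed

lemma independent_sequence:
  assumes tors: "\<And>g. g \<in> carrier G \<Longrightarrow> \<exists>n\<ge>1. g [^] (n::nat) = \<one>"
    and unb: "\<And>n::nat. n \<ge> 1 \<Longrightarrow> \<exists>g\<in>carrier G. g [^] n \<noteq> \<one>"
  obtains x and q :: "nat \<Rightarrow> nat"
  where "range x \<subseteq> carrier G" "\<And>i j. i \<le> j \<Longrightarrow> q i dvd q j" "\<And>i j. i < j \<Longrightarrow> x i [^] q j = \<one>"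
    "\<And>c n. 1 \<le> c \<Longrightarrow> c \<le> n \<Longrightarrow> x n [^] (c * q n) \<noteq> \<one>"
    "\<And>g. g \<in> carrier G \<Longrightarrow> \<exists>n. g [^] q n = \<one>"
proof -
  obtain t :: "'a \<Rightarrow> nat" where t: "\<And>g. g \<in> carrier G \<Longrightarrow> t g \<ge> 1 \<and> g [^] t g = \<one>"
    using tors by metis
  obtain s :: "nat \<Rightarrow> 'a" where s: "\<And>n. n \<ge> 1 \<Longrightarrow> s n \<in> carrier G \<and> s n [^] n \<noteq> \<one>"
    using unb by metis
  define q where "q = rec_nat 1 (\<lambda>n r. Suc n * r * t (s (fact n * r)))"
  define x where "x n = s (fact n * q n)" for n
  have q_0: "q 0 = 1" and q_Suc: "q (Suc n) = Suc n * q n * t (x n)" for n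
    by (simp_all add: q_def x_def)
  have q_pos: "q n \<ge> 1 \<and> x n \<in> carrier G" for n
  proof (induction n)
    case 0 show ?case using s[of 1] by (simp add: x_def q_0)
  next
    case (Suc n)
    then have "1 \<le> q (Suc n)" using t[of "x n"] by (simp add: q_Suc Suc_le_eq)
    then have "1 \<le> fact (Suc n) * q (Suc n)" by (simp only: Suc_le_eq One_nat_def) simp
    then show ?case using \<open>1 \<le> q (Suc n)\<close> s unfolding x_def by blast
  qed
  then have xG: "x n \<in> carrier G" for n by blast
  have dvd: "q i dvd q j" if "i \<le> j" for i j
    using that by (induction j rule: dec_induct) (auto simp: q_Suc intro: dvd_trans)
  show ?thesis
  proof (rule that[of x q])
    show "range x \<subseteq> carrier G" using xG by auto
    show "q i dvd q j" if "i \<le> j" for i j using that by (rule dvd)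
    show "x i [^] q j = \<one>" if "i < j" for i j
    proof (rule nat_pow_eq_one_dvd[OF xG])
      show "x i [^] t (x i) = \<one>" using t xG by blast
      have "t (x i) dvd q (Suc i)" by (simp add: q_Suc)
      then show "t (x i) dvd q j" using dvd[of "Suc i" j] that by (auto intro: dvd_trans)
    qed
    show "x n [^] (c * q n) \<noteq> \<one>" if "1 \<le> c" "c \<le> n" for c n
    proof
      assume "x n [^] (c * q n) = \<one>"
      moreover have "c * q n dvd fact n * q n" using that by (intro mult_dvd_mono dvd_fact) auto
      ultimately have "x n [^] (fact n * q n) = \<one>" using nat_pow_eq_one_dvd xG by blast
      moreover have "1 \<le> fact n * q n" using q_pos[of n] by (simp add: Suc_le_eq)
      ultimately show False using s[of "fact n * q n"] by (simp add: x_def)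
    qed
    fix g assume g: "g \<in> carrier G"
    obtain k where k: "t g = Suc k" using t[OF g] by (cases "t g") auto
    have "t g dvd q (t g)" unfolding k q_Suc by (metis dvd_triv_left mult.assoc)
    then show "\<exists>n. g [^] q n = \<one>" using nat_pow_eq_one_dvd[OF g] t[OF g] by blast
  qed
qed

text \<open>The set \<open>R n k\<close> consists of the products of \<open>k\<close> terms of index at least \<open>n\<close> of a sequence
  as in \<open>independent_sequence\<close>.\<close>
lemma unbounded_torsion_family:
  assumes tors: "\<And>g. g \<in> carrier G \<Longrightarrow> \<exists>n\<ge>1. g [^] (n::nat) = \<one>"
    and unb: "\<And>n::nat. n \<ge> 1 \<Longrightarrow> \<exists>g\<in>carrier G. g [^] n \<noteq> \<one>"
  obtains R :: "nat \<Rightarrow> nat \<Rightarrow> 'a set"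
  where "\<And>n k. R n k \<subseteq> carrier G" "\<And>n k. R n k \<noteq> {}" "\<And>n n' k. n \<le> n' \<Longrightarrow> R n' k \<subseteq> R n k"
    "\<And>n. R n 0 = {\<one>}"
    "\<And>n k l. R n (k + l) = {r \<otimes> s | r s. r \<in> R n k \<and> s \<in> R n l}"
    "\<And>a b k l n. a \<in> carrier G \<Longrightarrow> b \<in> carrier G \<Longrightarrow>
       \<exists>M. (\<lambda>r. b \<otimes> r) ` R M l \<subseteq> (\<lambda>r. a \<otimes> r) ` R n k \<or>
           (\<lambda>r. b \<otimes> r) ` R M l \<inter> (\<lambda>r. a \<otimes> r) ` R n k = {}"
    "\<And>n. \<exists>r\<in>R n 1. \<exists>s\<in>R n 1. r \<noteq> s"
proof -
  obtain x and q :: "nat \<Rightarrow> nat" where x: "range x \<subseteq> carrier G"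
    and q: "\<And>i j. i \<le> j \<Longrightarrow> q i dvd q j" and kill: "\<And>i j. i < j \<Longrightarrow> x i [^] q j = \<one>"
    and indep: "\<And>c n. 1 \<le> c \<Longrightarrow> c \<le> n \<Longrightarrow> x n [^] (c * q n) \<noteq> \<one>"
    and cover: "\<And>g. g \<in> carrier G \<Longrightarrow> \<exists>n. g [^] q n = \<one>"
    using independent_sequence[OF tors unb] by blast
  define R where "R n k = list_prod x ` {is. length is = k \<and> set is \<subseteq> {n..}}" for n k
  have R_add: "R n (k + l) = {r \<otimes> s | r s. r \<in> R n k \<and> s \<in> R n l}" for n k l
  proof (intro equalityI subsetI)
    fix z assume "z \<in> R n (k + l)"
    then obtain zs where zs: "z = list_prod x zs" "length zs = k + l" "set zs \<subseteq> {n..}"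
      by (auto simp: R_def)
    have "z = list_prod x (take k zs) \<otimes> list_prod x (drop k zs)"
      using x zs(1) by (simp flip: list_prod_append)
    moreover have "list_prod x (take k zs) \<in> R n k" "list_prod x (drop k zs) \<in> R n l"
      unfolding R_def using zs set_take_subset[of k zs] set_drop_subset[of k zs]
      by (auto intro!: imageI)
    ultimately show "z \<in> {r \<otimes> s | r s. r \<in> R n k \<and> s \<in> R n l}" by blast
  next
    fix z assume "z \<in> {r \<otimes> s | r s. r \<in> R n k \<and> s \<in> R n l}"
    then obtain rs ss where "z = list_prod x rs \<otimes> list_prod x ss"
      "length rs = k" "set rs \<subseteq> {n..}" "length ss = l" "set ss \<subseteq> {n..}"
      by (auto simp: R_def)
    then show "z \<in> R n (k + l)"
      unfolding R_def using x by (intro image_eqI[of _ _ "rs @ ss"]) (auto simp: list_prod_append)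
  qed
  show ?thesis
  proof (rule that[of R])
    show "R n k \<subseteq> carrier G" for n k using x by (auto simp: R_def)
    have "replicate k n \<in> {is. length is = k \<and> set is \<subseteq> {n..}}" for n k :: nat by auto
    then show "R n k \<noteq> {}" for n k unfolding R_def by blast
    show "R n' k \<subseteq> R n k" if "n \<le> n'" for n n' k using that unfolding R_def by (intro image_mono) auto
    show "R n 0 = {\<one>}" for n by (auto simp: R_def)
    show "R n (k + l) = {r \<otimes> s | r s. r \<in> R n k \<and> s \<in> R n l}" for n k l by (rule R_add)
    show "\<exists>r\<in>R n 1. \<exists>s\<in>R n 1. r \<noteq> s" for n
    proof -
      have "x (Suc n) [^] (1 * q (Suc n)) \<noteq> \<one>" by (intro indep) auto
      then have "x n \<noteq> x (Suc n)" using kill[of n "Suc n"] by auto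
      moreover have "x i \<in> R n 1" if "n \<le> i" for i
        unfolding R_def using x that by (intro image_eqI[of _ _ "[i]"]) (auto simp: range_subsetD)
      ultimately show ?thesis using le_SucI[of n n] by blast
    qed
    fix a b k l n assume ab: "a \<in> carrier G" "b \<in> carrier G"
    then obtain M0 where M0: "(inv a \<otimes> b) [^] q M0 = \<one>" using cover by fastforce
    define M where "M = max n (max (k + l) M0)"
    have "n \<le> M" by (simp add: M_def)
    have gM: "(inv a \<otimes> b) [^] q M = \<one>"
      using q[of M0 M] ab by (intro nat_pow_eq_one_dvd[OF _ M0]) (auto simp: M_def)
    show "\<exists>M. (\<lambda>r. b \<otimes> r) ` R M l \<subseteq> (\<lambda>r. a \<otimes> r) ` R n k \<or>
           (\<lambda>r. b \<otimes> r) ` R M l \<inter> (\<lambda>r. a \<otimes> r) ` R n k = {}"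
    proof (cases "(\<lambda>r. b \<otimes> r) ` R M l \<inter> (\<lambda>r. a \<otimes> r) ` R n k = {}")
      case False
      then obtain ms ns where ms: "length ms = l" "set ms \<subseteq> {M..}"
        and ns: "length ns = k" "set ns \<subseteq> {n..}" and eq: "b \<otimes> list_prod x ms = a \<otimes> list_prod x ns"
        by (auto simp: R_def)
      have "(inv a \<otimes> b) \<otimes> list_prod x ms = inv a \<otimes> (a \<otimes> list_prod x ns)"
        using ab x by (simp add: m_assoc flip: eq)
      also have "\<dots> = list_prod x ns" using ab x by (simp flip: m_assoc)
      finally have eq': "(inv a \<otimes> b) \<otimes> list_prod x ms = list_prod x ns" .
      have len: "set ms \<subseteq> {M..}" "length ms \<le> M" "length ns \<le> M"
        using ms ns by (auto simp: M_def)
      have "inv a \<otimes> b \<in> carrier G" using ab by simp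
      from list_prod_cancel[OF x q kill indep this gM len eq']
      obtain ns' where ns': "set ns' \<subseteq> set ns" "length ns' + length ms = length ns"
        "inv a \<otimes> b = list_prod x ns'"
        by blast
      have "b = a \<otimes> list_prod x ns'" using ab by (simp flip: ns'(3) m_assoc)
      have "(\<lambda>r. b \<otimes> r) ` R M l \<subseteq> (\<lambda>r. a \<otimes> r) ` R n k"
      proof
        fix z assume "z \<in> (\<lambda>r. b \<otimes> r) ` R M l"
        then obtain rs where rs: "length rs = l" "set rs \<subseteq> {M..}" "z = b \<otimes> list_prod x rs"
          by (auto simp: R_def)
        have "z = a \<otimes> list_prod x (ns' @ rs)"
          using rs(3) \<open>b = a \<otimes> list_prod x ns'\<close> x ab by (simp add: list_prod_append m_assoc)
        moreover have "list_prod x (ns' @ rs) \<in> R n k"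
          unfolding R_def using ns' ns ms rs \<open>n \<le> M\<close> by (intro imageI) auto
        ultimately show "z \<in> (\<lambda>r. a \<otimes> r) ` R n k" by blast
      qed
      then show ?thesis by blast
    qed blast
  qed
qed

end

section \<open>Nil semigroups\<close>

text \<open>Take a maximal \<open>M\<close> with \<open>MM = {e}\<close>. If it is finite, then so are the sets \<open>aX\<close> for
  \<open>a \<in> M\<close>, hence all sufficiently high powers of all elements annihilate \<open>M\<close>, and a new power of
  an element of large index can be added to \<open>M\<close>.\<close>
lemma (in carrier_comm_semigroup) nil_unbounded_singular:
  assumes e: "e \<in> X" "\<And>x. x \<in> X \<Longrightarrow> m e x = e"
    and nil: "\<And>x. x \<in> X \<Longrightarrow> \<exists>n\<ge>1. pw x n = e"
    and unb: "\<And>n. n \<ge> 1 \<Longrightarrow> \<exists>x\<in>X. pw x n \<noteq> e"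
  shows "singular X m"
proof (rule ccontr)
  assume nonsing: "\<not> singular X m"
  have xe: "m x e = e" if "x \<in> X" for x using e that comm by metis
  have fin: "finite A" if "A \<subseteq> X" "\<And>a b. a \<in> A \<Longrightarrow> b \<in> A \<Longrightarrow> m a b = e" for A
  proof (rule ccontr)
    assume "infinite A"
    then show False using nonsing singularI[OF that(1) _ that(2)] by simp
  qed
  define \<A> where "\<A> = {M. M \<subseteq> X \<and> (\<forall>a\<in>M. \<forall>b\<in>M. m a b = e)}"
  have "\<exists>M\<in>\<A>. \<forall>L\<in>\<A>. M \<subseteq> L \<longrightarrow> L = M"
  proof (rule Zorn_Lemma2, rule ballI)
    fix C assume C: "C \<in> chains \<A>"
    have "m a b = e" if ab: "a \<in> \<Union>C" "b \<in> \<Union>C" for a b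
    proof -
      obtain K L where KL: "K \<in> C" "L \<in> C" "a \<in> K" "b \<in> L" using ab by blast
      then have "K \<subseteq> L \<or> L \<subseteq> K" using chainsD[OF C] by blast
      then have "\<exists>N\<in>C. a \<in> N \<and> b \<in> N" using KL by blast
      then show ?thesis using chainsD2[OF C] by (auto simp: \<A>_def)
    qed
    then have "\<Union>C \<in> \<A>" using chainsD2[OF C] by (auto simp: \<A>_def)
    then show "\<exists>U\<in>\<A>. \<forall>L\<in>C. L \<subseteq> U" by blast
  qed
  then obtain M where M: "M \<subseteq> X" "\<And>a b. a \<in> M \<Longrightarrow> b \<in> M \<Longrightarrow> m a b = e"
    and Mmax: "\<And>L. L \<in> \<A> \<Longrightarrow> M \<subseteq> L \<Longrightarrow> L = M"
    unfolding \<A>_def by auto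
  have "finite M" using M fin by blast
  have finM: "finite (m a ` X)" if "a \<in> M" for a
  proof (rule fin)
    show "m a ` X \<subseteq> X" using that M(1) by auto
    fix u v assume "u \<in> m a ` X" "v \<in> m a ` X"
    then obtain x y where "x \<in> X" "y \<in> X" "u = m a x" "v = m a y" by blast
    then have "m u v = m (m a a) (m x y)" using that M(1) by (auto simp: interchange)
    then show "m u v = e" using M(2)[OF that that] e \<open>x \<in> X\<close> \<open>y \<in> X\<close> by simp
  qed
  define R where "R = Suc (\<Sum>a\<in>M. card (m a ` X))"
  have kill: "m a (pw y k) = e" if a: "a \<in> M" and y: "y \<in> X" and k: "R \<le> k" for a y k
  proof -
    have aX: "a \<in> X" using a M(1) by blast
    have "card (m a ` X) < R"
      using member_le_sum[of a M "\<lambda>a. card (m a ` X)"] a \<open>finite M\<close> by (simp add: R_def)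
    moreover have "card ((\<lambda>i. m a (pw y i)) ` {1..R}) \<le> card (m a ` X)"
      using finM[OF a] y by (intro card_mono) auto
    ultimately have "\<not> inj_on (\<lambda>i. m a (pw y i)) {1..R}"
      using pigeonhole[of "\<lambda>i. m a (pw y i)" "{1..R}"] by simp
    then obtain i j where "i \<in> {1..R}" "j \<in> {1..R}" "i \<noteq> j" "m a (pw y i) = m a (pw y j)"
      unfolding inj_on_def by blast
    then obtain i j where ij: "1 \<le> i" "i < j" "j \<le> R" "m a (pw y i) = m a (pw y j)"
      by (metis atLeastAtMost_iff linorder_neqE_nat)
    define r where "r = j - i"
    have r: "1 \<le> r" "j = i + r" using ij by (auto simp: r_def)
    have add: "m a (pw y (s + t)) = m (m a (pw y s)) (pw y t)" if "1 \<le> s" "1 \<le> t" for s t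
      using that y aX by (simp add: pw_add assoc)
    have per: "m a (pw y (i + r * l)) = m a (pw y i)" for l
    proof (induction l)
      case (Suc l)
      have "m a (pw y (i + r * Suc l)) = m a (pw y ((i + r * l) + r))" by (simp add: algebra_simps)
      also have "\<dots> = m (m a (pw y i)) (pw y r)" using add[of "i + r * l" r] Suc r ij by simp
      also have "\<dots> = m a (pw y i)" using add[of i r] r ij by simp
      finally show ?case .
    qed simp
    obtain n where n: "1 \<le> n" "pw y n = e" using nil[OF y] by blast
    have "m a (pw y (i + r * n)) = m (m a (pw y i)) (pw (pw y n) r)"
      using add[of i "n * r"] pw_mult[of y n r] n r ij y by (simp add: mult.commute)
    also have "\<dots> = e" using n e xe y aX by (simp add: pw_idempotent)
    finally have "m a (pw y i) = e" using per by simp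
    moreover have "m a (pw y k) = m (m a (pw y i)) (pw y (k - i))"
      using add[of i "k - i"] ij k by simp
    ultimately show ?thesis using e y by simp
  qed
  define c where "c = card M"
  obtain y where y: "y \<in> X" "pw y (2 * (R + c + 1)) \<noteq> e" using unb[of "2 * (R + c + 1)"] by auto
  have high: "pw y k = e" if "pw y n = e" "1 \<le> n" "n \<le> k" for n k
  proof (cases "n = k")
    case False
    then have "pw y (n + (k - n)) = m (pw y n) (pw y (k - n))" using that y by (intro pw_add) auto
    then show ?thesis using that e y by simp
  qed (use that in simp)
  define k where "k = (LEAST n. 1 \<le> n \<and> pw y n = e)"
  have k: "1 \<le> k" "pw y k = e" and k_least: "\<And>n. 1 \<le> n \<Longrightarrow> pw y n = e \<Longrightarrow> k \<le> n"
    using LeastI_ex[of "\<lambda>n. 1 \<le> n \<and> pw y n = e"] nil[OF y(1)] Least_le[of "\<lambda>n. 1 \<le> n \<and> pw y n = e"]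
    unfolding k_def by auto
  have k_big: "2 * (R + c + 1) < k"
    using y(2) high[OF k(2,1)] not_le by blast
  have inj: "inj_on (pw y) {k - c - 1..<k}"
  proof (rule linorder_inj_onI')
    fix i j assume ij: "i \<in> {k - c - 1..<k}" "j \<in> {k - c - 1..<k}" "i < j"
    show "pw y i \<noteq> pw y j"
    proof
      assume eq: "pw y i = pw y j"
      have i: "1 \<le> i" using ij k_big by auto
      obtain n where n: "1 \<le> n" "pw y n = e" using nil[OF y(1)] by blast
      have "1 \<le> j - i" using ij(3) by linarith
      then have "n \<le> n * (j - i)" by simp
      then have "n \<le> i + n * (j - i)" by (rule trans_le_add2)
      then have "pw y (i + n * (j - i)) = e" using high[OF n(2,1)] by blast
      then have "pw y i = e" using pw_eq_periodic[OF y(1) i ij(3) eq order_refl] by simp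
      then show False using k_least[OF i] ij by simp
    qed
  qed
  have "\<not> pw y ` {k - c - 1..<k} \<subseteq> M"
  proof
    assume "pw y ` {k - c - 1..<k} \<subseteq> M"
    then have "card {k - c - 1..<k} \<le> c"
      using card_inj_on_le[OF inj _ \<open>finite M\<close>] by (simp add: c_def)
    then show False using k_big by simp
  qed
  then obtain j where j: "k - c - 1 \<le> j" "j < k" "pw y j \<notin> M"
    unfolding image_subset_iff Ball_def atLeastLessThan_iff by blast
  have "m (pw y j) (pw y j) = pw y (j + j)" using y j k_big by (intro pw_add[symmetric]) auto
  also have "\<dots> = e" using j k_big by (intro high[OF k(2,1)]) auto
  finally have jj: "m (pw y j) (pw y j) = e" .
  have ja: "m a (pw y j) = e" if "a \<in> M" for a
    using j k_big that y by (intro kill) auto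
  moreover have "m (pw y j) a = e" if "a \<in> M" for a
    using ja[OF that] comm[of a "pw y j"] that M(1) y by auto
  ultimately have "insert (pw y j) M \<in> \<A>"
    using M jj y by (auto simp: \<A>_def)
  then have "insert (pw y j) M = M" by (intro Mmax) auto
  then show False using j by blast
qed

section \<open>Closedness of bounded nonsingular semigroups\<close>

lemma closure_of_open_meets:
  assumes "z \<in> S closure_of D" "openin S V" "z \<in> V" shows "V \<inter> D \<noteq> {}"
  using assms by (fastforce simp: in_closure_of)

lemma t1_closure_of_finite_meet:
  assumes "t1_space S" "z \<in> S closure_of D" "openin S V" "z \<in> V" "finite (V \<inter> D)"
  shows "z \<in> D"
proof (rule ccontr)
  assume "z \<notin> D"
  have "closedin S (V \<inter> D)"
    using assms(1,3,5) openin_subset[OF assms(3)] by (simp add: t1_space_closedin_finite le_infI1)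
  then have "openin S (V - V \<inter> D)" using assms(3) by (rule openin_diff[rotated])
  then show False
    using closure_of_open_meets[OF assms(2), of "V - V \<inter> D"] assms(4) \<open>z \<notin> D\<close> by blast
qed

lemma bounded_nonsingular_closedin:
  assumes top: "topological_semigroup (S, n)" and t1: "t1_space S" and DS: "D \<subseteq> topspace S"
    and D: "is_semigroup D n" "is_commutative D n" "nonsingular D n"
    and N: "N \<ge> 1" "\<And>x. x \<in> D \<Longrightarrow> semigroup_power n x N = e" and e: "e \<in> D" and ee: "n e e = e"
    and discrete: "\<And>d. d \<in> D \<Longrightarrow> \<exists>U. openin S U \<and> U \<inter> D = {d}"
  shows "closedin S D"
proof -
  interpret S: carrier_semigroup "topspace S" n
    using top by unfold_locales (simp add: topological_semigroup_def)
  interpret D: carrier_comm_semigroup D n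
    using D by unfold_locales
  have cont: "continuous_map (prod_topology S S) S (\<lambda>(x, y). n x y)"
    using top by (simp add: topological_semigroup_def)
  have cont_n: "continuous_map T S (\<lambda>t. n (f t) (g t))"
    if "continuous_map T S f" "continuous_map T S g" for T :: "'t topology" and f g
    using continuous_map_compose[OF _ cont, of T "\<lambda>t. (f t, g t)"] that
    by (simp add: continuous_map_pairedI o_def)
  have cont_pw: "continuous_map S S (\<lambda>y. S.pw y k)" if "k \<ge> 1" for k
    using that
    by (induction k rule: nat_induct_at_least)
      (auto simp: S.pw_Suc intro: continuous_map_id[unfolded id_def] continuous_map_from_subtopology
        intro!: cont_n[OF continuous_map_id[unfolded id_def]])
  have nbhd: "\<exists>V. openin S V \<and> z \<in> V \<and> (\<forall>a\<in>V. \<forall>b\<in>V. n a (g b) \<in> U)"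
    if gzU: "continuous_map S S g" "z \<in> topspace S" "openin S U" "n z (g z) \<in> U" for g z U
  proof -
    have cont_g: "continuous_map (prod_topology S S) S (\<lambda>t. n (fst t) (g (snd t)))"
      using continuous_map_compose[OF continuous_map_snd gzU(1)]
      by (intro cont_n continuous_map_fst) (simp add: o_def)
    define W where "W = {t \<in> topspace (prod_topology S S). n (fst t) (g (snd t)) \<in> U}"
    have "openin (prod_topology S S) W"
      unfolding W_def using cont_g gzU(3) by (rule openin_continuous_map_preimage)
    moreover have "(z, z) \<in> W"
      using gzU(2,4) by (simp add: W_def)
    ultimately obtain V V' where "openin S V" "openin S V'" "z \<in> V" "z \<in> V'" "V \<times> V' \<subseteq> W"
      unfolding openin_prod_topology_alt by metis
    moreover have "n a (g b) \<in> U" if "(a, b) \<in> W" for a b using that by (simp add: W_def)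
    ultimately show ?thesis by (intro exI[of _ "V \<inter> V'"]) auto
  qed
  have eN: "S.pw y N = e" if "y \<in> S closure_of D" for y
  proof -
    have "closedin S {e}" using t1 e DS by (auto simp: t1_space_closedin_singleton)
    then have "closedin S {y \<in> topspace S. S.pw y N \<in> {e}}"
      using cont_pw[OF N(1)] closedin_continuous_map_preimage by blast
    then have "S closure_of D \<subseteq> {y \<in> topspace S. S.pw y N \<in> {e}}"
      using N(2) DS by (intro closure_of_minimal) auto
    with that show ?thesis by blast
  qed
  have closure_pw: "S.pw y k \<in> S closure_of ((\<lambda>x. S.pw x k) ` D)"
    if "y \<in> S closure_of D" "k \<ge> 1" for y k
    using continuous_map_image_closure_subset[OF cont_pw[OF that(2)]] that(1) by blast
  have closure_pw': "S.pw y k \<in> S closure_of D" if "y \<in> S closure_of D" "k \<ge> 1" for y k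
    using closure_pw[OF that] closure_of_mono[of "(\<lambda>x. S.pw x k) ` D" D S] D.pw_closed by blast
  have high: "S.pw y p \<in> D" if y: "y \<in> S closure_of D" and p: "p \<ge> N + 1" for y p
  proof -
    define z where "z = S.pw y p"
    define E where "E = (\<lambda>x. S.pw x p) ` D"
    have z: "z \<in> S closure_of E" "z \<in> S closure_of D"
      using closure_pw[OF y, of p] closure_pw'[OF y, of p] p by (simp_all add: z_def E_def)
    then have zS: "z \<in> topspace S" by (simp add: in_closure_of)
    have ED: "E \<subseteq> D" by (auto simp: E_def)
    have Ee: "n a e = a" if a: "a \<in> E" for a
    proof -
      obtain x where x: "x \<in> D" "a = S.pw x p" using a by (auto simp: E_def)
      have "S.pw x p = n (S.pw x (p - N)) (S.pw x N)"
        using x p N(1) by (subst D.pw_add[symmetric]) auto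
      then have "a = n (S.pw x (p - N)) e" using x N by simp
      then show ?thesis using x e ee by (simp add: D.assoc)
    qed
    define g where "g b = S.pw b (2 * N - 1)" for b
    have g: "n b (g b) = S.pw b (2 * N)" if "b \<in> topspace S" for b
      using that N(1) S.pw_Suc[of "2 * N - 1" b] by (simp add: g_def)
    have pw_2N: "S.pw b (2 * N) = e" if "b \<in> S closure_of D" for b
      using S.pw_add[of b N N] eN[OF that] that N(1) ee by (simp add: mult_2 in_closure_of)
    obtain U where U: "openin S U" "U \<inter> D = {e}" using discrete[OF e] by blast
    have "continuous_map S S g" unfolding g_def using N(1) by (intro cont_pw) simp
    moreover have "n z (g z) \<in> U" using g[OF zS] pw_2N[OF z(2)] U(2) by auto
    ultimately obtain V where V: "openin S V" "z \<in> V" "\<And>a b. a \<in> V \<Longrightarrow> b \<in> V \<Longrightarrow> n a (g b) \<in> U"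
      using nbhd zS U(1) by meson
    have eq: "a = b" if ab: "a \<in> V \<inter> E" "b \<in> V \<inter> E" for a b
    proof -
      have abD: "a \<in> D" "b \<in> D" "g b \<in> D" using ab ED by (auto simp: g_def)
      have "n (g b) b = n b (g b)" using abD D.comm by blast
      also have "\<dots> = e" using abD DS closure_of_subset[OF DS] g pw_2N by blast
      finally have "n (g b) b = e" .
      moreover have "n a (g b) = e" using V(3)[of a b] ab abD U(2) by blast
      ultimately have "n a e = n e b" using abD D.assoc[of a "g b" b] by simp
      then show ?thesis using Ee ab D.comm[OF e abD(2)] by simp
    qed
    obtain b where "b \<in> V \<inter> E" using closure_of_open_meets[OF z(1) V(1,2)] by blast
    then have "V \<inter> E = {b}" using eq by blast
    then have "z \<in> E" using t1_closure_of_finite_meet[OF t1 z(1) V(1,2)] by simp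
    then show ?thesis using ED by (auto simp: z_def)
  qed
  have double: "z \<in> D" if z: "z \<in> S closure_of D" and zz: "n z z \<in> D" for z
  proof -
    have zS: "z \<in> topspace S" using z by (simp add: in_closure_of)
    obtain U where U: "openin S U" "U \<inter> D = {n z z}" using discrete[OF zz] by blast
    then have "n z z \<in> U" by blast
    then obtain V where V: "openin S V" "z \<in> V" "\<And>a b. a \<in> V \<Longrightarrow> b \<in> V \<Longrightarrow> n a b \<in> U"
      using nbhd[of "\<lambda>y. y" z U] zS U(1) continuous_map_id[of S, unfolded id_def] by auto
    have mult: "n a b = n z z" if "a \<in> V \<inter> D" "b \<in> V \<inter> D" for a b
      using that V(3)[of a b] U(2) by blast
    then have "finite (V \<inter> D)"
      using D(3) singularI[of "V \<inter> D" D n "n z z"] unfolding nonsingular_def by blast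
    then show ?thesis using t1_closure_of_finite_meet[OF t1 z V(1,2)] by blast
  qed
  have "y \<in> D" if y: "y \<in> S closure_of D" for y
  proof -
    have yS: "y \<in> topspace S" using y by (simp add: in_closure_of)
    have "S.pw y (2 ^ i) \<in> D \<longrightarrow> y \<in> D" for i
    proof (induction i)
      case (Suc i)
      have "S.pw y (2 ^ Suc i) = n (S.pw y (2 ^ i)) (S.pw y (2 ^ i))"
        using yS S.pw_add[of y "2 ^ i" "2 ^ i"] by (simp add: mult_2)
      moreover have "S.pw y (2 ^ i) \<in> S closure_of D" using y by (rule closure_pw') simp
      ultimately show ?case using Suc.IH double by metis
    qed simp
    moreover have "N + 1 \<le> 2 ^ (N + 1)" using less_exp[of "N + 1"] by linarith
    ultimately show ?thesis using high[OF y] by blast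
  qed
  then show ?thesis using DS by (intro closure_of_subset_eq[THEN iffD1]) auto
qed

section \<open>Unipotent commutative semigroups\<close>

text \<open>A filter family on the group \<open>eX\<close> is also one for \<open>X\<close>, which acts on \<open>eX\<close> through the
  retraction \<open>x \<mapsto> ex\<close>.\<close>
lemma (in carrier_comm_semigroup) unbounded_group_not_closed:
  fixes \<C> :: "'b topsemigroup set"
  assumes TzS: "TzS \<subseteq> \<C>" and cardX: "X \<lesssim> (UNIV :: 'b set)"
    and e: "e \<in> X" "m e e = e" and per: "\<And>x. x \<in> X \<Longrightarrow> \<exists>n\<ge>1. pw x n = e"
    and unb: "\<And>n. n \<ge> 1 \<Longrightarrow> \<exists>x\<in>X. pw (m e x) n \<noteq> e"
  shows "\<not> closed_semigroup \<C> X m"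
proof -
  define H where "H = m e ` X"
  define G where "G = \<lparr>carrier = H, mult = m, one = e\<rparr>"
  have G_simps [simp]: "carrier G = H" "mult G = m" "one G = e" by (simp_all add: G_def)
  have HX: "H \<subseteq> X" using e by (auto simp: H_def)
  have HXD: "h \<in> X" if "h \<in> H" for h using that HX by blast
  have eH: "e \<in> H" unfolding H_def using e by (metis imageI)
  have e_left: "m e h = h" if "h \<in> H" for h
    using that e by (auto simp: H_def assoc[symmetric])
  have XH: "m x h \<in> H" if "x \<in> X" "h \<in> H" for x h
  proof -
    have "m x h = m e (m x h)" using that e e_left left_comm[of e x h] HXD by simp
    then show ?thesis unfolding H_def using that HXD by blast
  qed
  interpret comm_group G
  proof (rule comm_groupI; simp)
    show "m x y \<in> H" if "x \<in> H" "y \<in> H" for x y using that XH HXD by blast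
    show "e \<in> H" by (rule eH)
    show "m (m x y) z = m x (m y z)" if "x \<in> H" "y \<in> H" "z \<in> H" for x y z
      using that HXD by (simp add: assoc)
    show "m x y = m y x" if "x \<in> H" "y \<in> H" for x y using that HXD comm by blast
    show "m e x = x" if "x \<in> H" for x using that by (rule e_left)
    show "\<exists>y\<in>H. m y x = e" if x: "x \<in> H" for x
    proof -
      obtain n where n: "n \<ge> 1" "pw x n = e" using per HXD x by blast
      define w where "w = pw x (2 * n - 1)"
      have wX: "w \<in> X" using HXD[OF x] by (simp add: w_def)
      have "pw x (2 * n) = m (pw x n) (pw x n)" using pw_add[of x n n] HXD[OF x] n by (simp add: mult_2)
      then have "pw x (2 * n) = e" using n e by simp
      moreover have "pw x (2 * n) = m x w"
        using pw_Suc[of "2 * n - 1" x] n by (simp add: w_def)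
      ultimately have "m w x = e" using comm[OF wX HXD[OF x]] by simp
      then have "m (m e w) x = e" using assoc[OF e(1) wX HXD[OF x]] e(2) by simp
      moreover have "m e w \<in> H" using wX by (simp add: H_def)
      ultimately show ?thesis by blast
    qed
  qed
  have pow: "h [^]\<^bsub>G\<^esub> n = pw h n" if "h \<in> H" "n \<ge> 1" for h and n :: nat
    using that(2)
  proof (induction n rule: nat_induct_at_least)
    case base
    show ?case using that e_left by simp
  next
    case (Suc n)
    then show ?case using that HXD comm[of "pw h n" h] by (simp add: pw_Suc)
  qed
  have tors: "\<exists>n\<ge>1. g [^]\<^bsub>G\<^esub> (n::nat) = \<one>\<^bsub>G\<^esub>" if "g \<in> carrier G" for g
    using per[of g] pow[of g] HXD[of g] that by auto
  have unbG: "\<exists>g\<in>carrier G. g [^]\<^bsub>G\<^esub> n \<noteq> \<one>\<^bsub>G\<^esub>" if "n \<ge> 1" for n :: nat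
    using unb[OF that] pow[OF _ that] by (auto simp: H_def)
  obtain R :: "nat \<Rightarrow> nat \<Rightarrow> 'a set" where
    R: "\<And>n k. R n k \<subseteq> H" "\<And>n k. R n k \<noteq> {}" "\<And>n n' k. n \<le> n' \<Longrightarrow> R n' k \<subseteq> R n k" "\<And>n. R n 0 = {e}"
    and R_add: "\<And>n k l. R n (k + l) = {m r s | r s. r \<in> R n k \<and> s \<in> R n l}"
    and R_dec: "\<And>a b k l n. a \<in> H \<Longrightarrow> b \<in> H \<Longrightarrow>
       \<exists>M. m b ` R M l \<subseteq> m a ` R n k \<or> m b ` R M l \<inter> m a ` R n k = {}"
    and R1: "\<And>n. \<exists>r\<in>R n 1. \<exists>s\<in>R n 1. r \<noteq> s"
    by (rule unbounded_torsion_family[OF tors unbG, unfolded G_simps]) (assumption+, rule that, assumption+)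
  have RX: "r \<in> X" if "r \<in> R n k" for r n k using that R(1) HXD by blast
  define D where "D = (\<lambda>(a, k) n. m a ` R n k)"
  have D [simp]: "D (a, k) n = m a ` R n k" for a k n by (simp add: D_def)
  show ?thesis
  proof (rule base_filter_family_not_closed[OF TzS cardX, of "H \<times> UNIV" D "(e, 1)"])
    show "H \<times> (UNIV :: nat set) \<lesssim> X \<times> (UNIV :: nat set)"
      using HX by (intro subset_imp_lepoll) auto
    show "antimono (D i)" for i
      by (cases i) (simp add: antimonoI image_mono R(3))
    show "D i n \<subseteq> X" "D i n \<noteq> {}" if "i \<in> H \<times> UNIV" for i n
      using that R(2) RX HXD by (auto simp: D_def)
    show "\<exists>k\<in>H \<times> UNIV. (\<forall>n. \<exists>l. D k l \<subseteq> {m x y |x y. x \<in> D i n \<and> y \<in> D j n}) \<and>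
        (\<forall>n. \<exists>l. {m x y |x y. x \<in> D i l \<and> y \<in> D j l} \<subseteq> D k n)"
      if ij: "i \<in> H \<times> UNIV" "j \<in> H \<times> UNIV" for i j
    proof -
      obtain a k b l where ab: "i = (a, k)" "j = (b, l)" "a \<in> H" "b \<in> H" using ij by auto
      have eq: "m (m a b) (m r s) = m (m a r) (m b s)" if "r \<in> R n k" "s \<in> R n l" for r s n
        using ab RX that HXD by (intro interchange) auto
      have "D (m a b, k + l) n = {m x y |x y. x \<in> D i n \<and> y \<in> D j n}" for n
      proof (intro equalityI subsetI)
        fix z assume "z \<in> D (m a b, k + l) n"
        then obtain r s where "r \<in> R n k" "s \<in> R n l" "z = m (m a b) (m r s)" by (auto simp: R_add)
        then show "z \<in> {m x y |x y. x \<in> D i n \<and> y \<in> D j n}" using eq ab by auto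
      next
        fix z assume "z \<in> {m x y |x y. x \<in> D i n \<and> y \<in> D j n}"
        then obtain r s where rs: "r \<in> R n k" "s \<in> R n l" "z = m (m a r) (m b s)" by (auto simp: ab)
        then have "m r s \<in> R n (k + l)" by (auto simp: R_add)
        moreover have "z = m (m a b) (m r s)" using eq rs by simp
        ultimately show "z \<in> D (m a b, k + l) n" unfolding D by blast
      qed
      moreover have "(m a b, k + l) \<in> H \<times> UNIV" using ab XH HXD by auto
      ultimately show ?thesis by (metis subset_refl)
    qed
    show "\<exists>k\<in>H \<times> UNIV. \<forall>n. D k n = m x ` D i n" if x: "x \<in> X" and i: "i \<in> H \<times> UNIV" for x i
    proof -
      obtain a k where a: "i = (a, k)" "a \<in> H" using i by auto
      have "D (m x a, k) n = m x ` D i n" for n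
        using a x RX HXD by (auto simp: image_image assoc intro!: image_cong)
      then show ?thesis using XH[OF x a(2)] by blast
    qed
    show "\<exists>l. D j l \<subseteq> D i n \<or> D j l \<inter> D i n = {}"
      if "i \<in> H \<times> UNIV" "j \<in> H \<times> UNIV" for i j n
      using that R_dec by auto
    show "\<exists>l. D j l \<subseteq> {x} \<or> x \<notin> D j l" if x: "x \<in> X" and j: "j \<in> H \<times> UNIV" for x j
    proof -
      obtain b l where b: "j = (b, l)" "b \<in> H" using j by auto
      show ?thesis
      proof (cases "x \<in> H")
        case True
        have "m x e = x" using True e_left e HXD comm by metis
        then have "m x ` R 0 0 = {x}" by (simp add: R(4))
        then show ?thesis using R_dec[OF True b(2), of l 0 0] by (auto simp: b(1))
      next
        case False
        have "m b r \<in> H" if "r \<in> R 0 l" for r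
          using that b(2) XH HXD R(1) by blast
        with False have "x \<notin> D j 0" by (auto simp: b(1))
        then show ?thesis by blast
      qed
    qed
    show "(e, 1) \<in> H \<times> UNIV" using eH by simp
    show "\<not> D (e, 1) n \<subseteq> {x}" for n x
    proof -
      obtain r s where rs: "r \<in> R n 1" "s \<in> R n 1" "r \<noteq> s" using R1 by blast
      then have "m e r = r" "m e s = s" using R(1) e_left by blast+
      with rs have "r \<in> D (e, 1) n" "s \<in> D (e, 1) n" unfolding D by (metis imageI)+
      then show ?thesis using \<open>r \<noteq> s\<close> by blast
    qed
  qed
qed

lemma (in carrier_comm_semigroup) closed_imp_bounded:
  fixes \<C> :: "'b topsemigroup set"
  assumes TzS: "TzS \<subseteq> \<C>" and cardX: "X \<lesssim> (UNIV :: 'b set)"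
    and e: "e \<in> X" "m e e = e" and uniq: "\<And>x. x \<in> X \<Longrightarrow> Defs.idempotent m x \<Longrightarrow> x = e"
    and closed: "closed_semigroup \<C> X m"
  shows "bounded_semigroup X m"
proof -
  have per: "\<exists>n\<ge>1. pw x n = e" if "x \<in> X" for x
    using nonperiodic_not_closed[OF TzS cardX that] closed uniq that by blast
  obtain q where q: "q \<ge> 1" "\<And>x. x \<in> X \<Longrightarrow> pw (m e x) q = e"
    using unbounded_group_not_closed[OF TzS cardX e per] closed by blast
  define N where "N = {x \<in> X. m e x = e}"
  have NX: "N \<subseteq> X" by (auto simp: N_def)
  interpret N: carrier_comm_semigroup N m
  proof
    show "is_semigroup N m"
      using e by (auto simp: is_semigroup_def N_def assoc assoc[symmetric, of e])
    show "is_commutative N m"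
      by (auto simp: is_commutative_def N_def comm)
  qed
  have "\<exists>s\<ge>1. \<forall>x\<in>N. pw x s = e"
  proof (rule ccontr)
    assume "\<not> (\<exists>s\<ge>1. \<forall>x\<in>N. pw x s = e)"
    then have unb: "\<exists>x\<in>N. pw x n \<noteq> e" if "n \<ge> 1" for n using that by blast
    have nil: "\<exists>n\<ge>1. pw x n = e" if "x \<in> N" for x using per that NX by blast
    have "e \<in> N" using e by (simp add: N_def)
    then have "singular N m"
      by (rule N.nil_unbounded_singular[OF _ _ nil unb]) (simp add: N_def)
    then have "singular X m" using NX unfolding singular_def by blast
    then show False using singular_not_closed[OF TzS cardX] closed by blast
  qed
  then obtain s where s: "s \<ge> 1" "\<And>x. x \<in> N \<Longrightarrow> pw x s = e" by blast
  have "pw x (q * s) = e" if x: "x \<in> X" for x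
  proof -
    have "m e (pw x q) = pw (m e x) q"
      using x e q(1) by (simp add: pw_distrib pw_idempotent)
    then have "pw x q \<in> N" using q(2)[OF x] x by (simp add: N_def)
    then show ?thesis using s pw_mult[OF x q(1) s(1)] by simp
  qed
  then show ?thesis
    using q(1) s(1) e unfolding bounded_semigroup_def Defs.idempotent_def
    by (intro exI[of _ "q * s"]) (simp add: Suc_le_eq)
qed

lemma (in carrier_comm_semigroup) bounded_nonsingular_closed:
  assumes T1: "\<C> \<subseteq> T1S" and e: "e \<in> X" "m e e = e"
    and uniq: "\<And>x. x \<in> X \<Longrightarrow> Defs.idempotent m x \<Longrightarrow> x = e"
    and bdd: "bounded_semigroup X m" and nonsing: "nonsingular X m"
  shows "closed_semigroup \<C> X m"
  unfolding closed_semigroup_def closed_topsemigroup_def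
proof (clarsimp)
  fix S n h
  assume SC: "(S, n) \<in> \<C>" and hom: "semigroup_hom X m (topspace S) n h"
    and emb: "embedding_map (discrete_topology X) S h"
  have top: "topological_semigroup (S, n)" "t1_space S" using SC T1 by (auto simp: T1S_def)
  have h_mult: "h (m x y) = n (h x) (h y)" if "x \<in> X" "y \<in> X" for x y
    using hom that by (simp add: semigroup_hom_def)
  have hS: "h ` X \<subseteq> topspace S" using hom by (simp add: semigroup_hom_def)
  have inj: "inj_on h X"
    using emb homeomorphic_imp_injective_map unfolding embedding_map_def by fastforce
  obtain N where N: "N \<ge> 1" "\<And>x. x \<in> X \<Longrightarrow> pw x N = e"
    using bdd uniq unfolding bounded_semigroup_def by blast
  interpret S: carrier_semigroup "topspace S" n
    using top by unfold_locales (simp add: topological_semigroup_def)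
  have h_pw: "S.pw (h x) k = h (pw x k)" if "x \<in> X" "k \<ge> 1" for x k
    using that(2) by (induction k rule: nat_induct_at_least)
      (use that in \<open>simp_all add: pw_Suc S.pw_Suc h_mult\<close>)
  show "closedin S (h ` X)"
  proof (rule bounded_nonsingular_closedin[OF top hS])
    show "is_semigroup (h ` X) n"
      by (auto simp: is_semigroup_def assoc simp flip: h_mult)
    show "is_commutative (h ` X) n"
      by (auto simp: is_commutative_def comm simp flip: h_mult)
    show "nonsingular (h ` X) n"
      unfolding nonsingular_def
    proof
      assume "singular (h ` X) n"
      then obtain A c where A: "A \<subseteq> h ` X" "infinite A" "{n a b |a b. a \<in> A \<and> b \<in> A} = {c}"
        unfolding singular_def by blast
      obtain B where B: "B \<subseteq> X" "A = h ` B" using A(1) by (auto simp: subset_image_iff)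
      have "infinite B" using A(2) B(2) by auto
      then obtain b0 where b0: "b0 \<in> B" by (metis finite.emptyI ex_in_conv)
      have mB: "m a b = m b0 b0" if "a \<in> B" "b \<in> B" for a b
      proof (rule inj_onD[OF inj])
        have "n (h a) (h b) \<in> {n a b |a b. a \<in> A \<and> b \<in> A}"
          "n (h b0) (h b0) \<in> {n a b |a b. a \<in> A \<and> b \<in> A}" using that b0 B(2) by blast+
        then show "h (m a b) = h (m b0 b0)"
          using A(3) that b0 B(1) h_mult by (metis singletonD subsetD)
      qed (use that b0 B in auto)
      then show False
        using nonsing singularI[OF B(1) \<open>infinite B\<close> mB] by (simp add: nonsingular_def)
    qed
    show "N \<ge> 1" by (rule N)
    show "S.pw x N = h e" if "x \<in> h ` X" for x using that N h_pw by auto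
    show "h e \<in> h ` X" using e by simp
    show "n (h e) (h e) = h e" using e h_mult[of e e] by simp
    show "\<exists>U. openin S U \<and> U \<inter> h ` X = {d}" if d: "d \<in> h ` X" for d
    proof -
      obtain x where x: "x \<in> X" "d = h x" using d by blast
      have "open_map (discrete_topology X) (subtopology S (h ` X)) h"
        using emb homeomorphic_imp_open_map by (fastforce simp: embedding_map_def)
      then have "openin (subtopology S (h ` X)) {d}"
        using x unfolding open_map_def by (metis image_empty image_insert openin_discrete_topology
          empty_subsetI insert_subset)
      then show ?thesis by (auto simp: openin_subtopology)
    qed
  qed
qed

theorem theorem1p4:
  fixes \<C> :: "'b topsemigroup set"
    and X :: "'a set" and m :: "'a \<Rightarrow> 'a \<Rightarrow> 'a"
  assumes "TzS \<subseteq> \<C>" and "\<C> \<subseteq> T1S"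
    and "X \<lesssim> (UNIV :: 'b set)"
    and "is_semigroup X m" and "is_commutative X m" and "unipotent X m"
  shows "closed_semigroup \<C> X m \<longleftrightarrow> bounded_semigroup X m \<and> nonsingular X m"
proof -
  interpret carrier_comm_semigroup X m
    using assms(4,5) by unfold_locales
  obtain e where e: "e \<in> X" "m e e = e" "\<And>x. x \<in> X \<Longrightarrow> Defs.idempotent m x \<Longrightarrow> x = e"
    using assms(6) unfolding unipotent_def Defs.idempotent_def by metis
  show ?thesis
    using closed_imp_bounded[OF assms(1,3) e] singular_not_closed[OF assms(1,3)]
      bounded_nonsingular_closed[OF assms(2) e]
    unfolding nonsingular_def by blast
qed

end
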